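(* Let $n\ge 1$ and let $\varphi_0=\prod_{j=1}^n\varphi_{0j}$, $\varphi_1=\prod_{j=1}^n\varphi_{1j}$ be two product densities (PDFs or PMFs) on $\Omega=\prod_{j=1}^n\Omega_j$ such that $D_{\mathrm{KL}}(\varphi_0\|\varphi_1)$ and $D_{\mathrm{KL}}(\varphi_1\|\varphi_0)$ are both positive real numbers. Let $\alpha^*:=\arg\max_{\alpha\in(0,1)}D_\alpha(\varphi_0\|\varphi_1)$, let $Y=(Y_1,\dots,Y_n)$ have independent components $Y_j\sim\varphi_{\alpha^* j}$ (so $Y\sim\varphi_{\alpha^*}$), put $l=\varphi_0/\varphi_1$, $l_j=\varphi_{0j}/\varphi_{1j}$, $$Z_j=\log l_j(Y_j)-\mathbb E[\log l_j(Y_j)],\qquad \bar\sigma_n=\Big(\frac1n\sum_{j=1}^n\mathrm{Var}[Z_j]\Big)^{1/2}.$$ Let $C_1>0$ and suppose $\sum_{j=1}^n\mathbb E|Z_j|^3\le C_1 n\bar\sigma_n^2$. Then there is a constant $C_2$ depending only on $C_1$ such that $$\mathbb E_{Y\sim\varphi_{\alpha^*}}[g_{\alpha^*}(\log l(Y))]\le\frac{C_2}{\sqrt n\,\bar\sigma_n(1-\alpha^* )\alpha^*}.$$ Furthermore, there are positive constants $C_3,C_4$ depending only on $C_1$ such that, if $\sqrt n\,\bar\sigma_n(1-\alpha^* )\alpha^*\ge C_3$, then $$\mathbb E_{Y\sim\varphi_{\alpha^*}}[g_{\alpha^*}(\log l(Y))]\ge\frac{C_4}{\sqrt n\,\bar\sigma_n(1-\alpha^*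 )\alpha^*}.$$ Consequently, if $\sqrt n\,\bar\sigma_n(1-\alpha^* )\alpha^*\ge C_3$, then $$\frac{C_4}{\sqrt n\,\bar\sigma_n\alpha^*(1-\alpha^* )}e^{-D_{\alpha^*}(\varphi_0\|\varphi_1)}\le\eta(\varphi_0,\varphi_1)\le\frac{C_2}{\sqrt n\,\bar\sigma_n\alpha^*(1-\alpha^* )}e^{-D_{\alpha^*}(\varphi_0\|\varphi_1)},$$ and the same two bounds hold for $2R(\hat z,z)$, where $R(\hat z,z)$ is the Bayes error probability.
   Context: For each $j\in[n]=\{1,\dots,n\}$, $\varphi_{0j}$ and $\varphi_{1j}$ are probability densities (of one-dimensional real random variables) with respect to the same $\sigma$-finite measure on a measurable space $(\Omega_j,\Sigma_j)$ (PMFs correspond to counting measure); $\Omega=\prod_j\Omega_j$ carries the product $\sigma$-algebra and product measure, written $\mu$, and $\varphi_z(x)=\prod_{j=1}^n\varphi_{zj}(x_j)$ for $z\in\{0,1\}$. Kullback–Leibler divergence: $D_{\mathrm{KL}}(\varphi_0\|\varphi_1)=\int_\Omega\varphi_0\log\frac{\varphi_0}{\varphi_1}\,d\mu$. Finiteness of both divergences means $\int_\Omega(\varphi_0+\varphi_1)|\log\frac{\varphi_1}{\varphi_0}|\,d\mu<\infty$; in particular $\varphi_0$ and $\varphi_1$ have the same support, and positivity means they differ on a set of positive measure. Chernoff $\alpha$-divergence, $\alpha\in(0,1)$: $D_\alpha(\varphi_0\|\varphi_1)=-\log\int_\Omega\varphi_0^{1-\alpha}\varphi_1^{\alpha}\,d\mu$,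 and likewise for $\varphi_{0j},\varphi_{1j}$ on $\Omega_j$. The maximal value over $\alpha\in(0,1)$, $D_{\alpha^*}(\varphi_0\|\varphi_1)$, is the Chernoff information; the maximizer $\alpha^*$ is unique. Tilted densities: $\varphi_\alpha=\varphi_0^{1-\alpha}\varphi_1^\alpha e^{D_\alpha(\varphi_0\|\varphi_1)}$ and $\varphi_{\alpha j}=\varphi_{0j}^{1-\alpha}\varphi_{1j}^\alpha e^{D_\alpha(\varphi_{0j}\|\varphi_{1j})}$. $g_\alpha(x)=\exp[\min(\alpha x,(\alpha-1)x)]$ for $x\in\mathbb R$. Total variation affinity: $\eta(\varphi_0,\varphi_1)=\int_\Omega\min(\varphi_0,\varphi_1)\,d\mu$. Bayes error: $z\in\{0,1\}$ is drawn with probability $1/2$ each and then $X\sim\varphi_z$; $\hat z(x)=\arg\max_{z\in\{0,1\}}\varphi_z(x)$ is the Bayes estimator and $R(\hat z,z)=\frac12\sum_{z\in\{0,1\}}\mathbb P(\hat z\ne z\mid X\sim\varphi_z)$. *)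

theory Defs
  imports "HOL-Probability.Probability"
begin

text \<open>A density of a probability measure with respect to \<open>M\<close>; probability mass functions are the
  case where \<open>M\<close> is a counting measure.\<close>

definition is_prob_density :: "'a measure \<Rightarrow> ('a \<Rightarrow> real) \<Rightarrow> bool" where
  "is_prob_density M p \<longleftrightarrow>
     p \<in> borel_measurable M \<and> (\<forall>x\<in>space M. 0 \<le> p x) \<and> prob_space (density M p)"

definition product_density :: "nat \<Rightarrow> (nat \<Rightarrow> 'a \<Rightarrow> real) \<Rightarrow> (nat \<Rightarrow> 'a) \<Rightarrow> real" where
  "product_density n p x = (\<Prod>j=1..n. p j (x j))"

text \<open>The Kullback--Leibler divergence, the integral of \<open>p log (p / q)\<close> with the usual conventions
  \<open>0 log (0 / q) = 0\<close> and \<open>p log (p / 0) = \<infinity>\<close> for \<open>p > 0\<close>. Both the integrand and the value are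
  extended reals, so that a divergent integral is \<open>\<infinity>\<close>; the constant \<open>KL_divergence\<close> of
  HOL-Probability is real-valued and is 0 in that case. The integral of the negative part is finite
  for all probability densities, so the difference below is never \<open>\<infinity> - \<infinity>\<close>.\<close>

definition KL_integrand :: "('a \<Rightarrow> real) \<Rightarrow> ('a \<Rightarrow> real) \<Rightarrow> 'a \<Rightarrow> ereal" where
  "KL_integrand p q x =
     (if p x = 0 then 0 else if q x = 0 then \<infinity> else ereal (p x * ln (p x / q x)))"

definition KL_div :: "'a measure \<Rightarrow> ('a \<Rightarrow> real) \<Rightarrow> ('a \<Rightarrow> real) \<Rightarrow> ereal" where
  "KL_div M p q =
     enn2ereal (\<integral>\<^sup>+ x. e2ennreal (KL_integrand p q x) \<partial>M)
     - enn2ereal (\<integral>\<^sup>+ x. e2ennreal (- KL_integrand p q x) \<partial>M)"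

text \<open>For \<open>0 < \<alpha> < 1\<close> and probability densities the integral exists and lies in \<open>[0, 1]\<close>. It is 0, in
  which case the real logarithm is a junk value, only if the densities have almost everywhere
  disjoint supports; this is impossible if one of the Kullback--Leibler divergences is finite.\<close>

definition chernoff_div :: "'a measure \<Rightarrow> ('a \<Rightarrow> real) \<Rightarrow> ('a \<Rightarrow> real) \<Rightarrow> real \<Rightarrow> real" where
  "chernoff_div M p q \<alpha> = - ln (\<integral>x. p x powr (1 - \<alpha>) * q x powr \<alpha> \<partial>M)"

definition chernoff_argmax :: "'a measure \<Rightarrow> ('a \<Rightarrow> real) \<Rightarrow> ('a \<Rightarrow> real) \<Rightarrow> real" where
  "chernoff_argmax M p q = arg_max (chernoff_div M p q) (\<lambda>\<alpha>. \<alpha> \<in> {0<..<1})"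

definition tilted_density ::
  "'a measure \<Rightarrow> ('a \<Rightarrow> real) \<Rightarrow> ('a \<Rightarrow> real) \<Rightarrow> real \<Rightarrow> 'a \<Rightarrow> real" where
  "tilted_density M p q \<alpha> x =
     p x powr (1 - \<alpha>) * q x powr \<alpha> * exp (chernoff_div M p q \<alpha>)"

definition g_fun :: "real \<Rightarrow> real \<Rightarrow> real" where
  "g_fun \<alpha> x = exp (min (\<alpha> * x) ((\<alpha> - 1) * x))"

definition tv_affinity :: "'a measure \<Rightarrow> ('a \<Rightarrow> real) \<Rightarrow> ('a \<Rightarrow> real) \<Rightarrow> real" where
  "tv_affinity M p q = (\<integral>x. min (p x) (q x) \<partial>M)"

text \<open>A measurable choice of \<open>argmax\<^sub>z p z x\<close> over \<open>z \<in> {0, 1}\<close>; ties may be broken in any way.\<close>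

definition is_bayes_estimator ::
  "'a measure \<Rightarrow> (nat \<Rightarrow> 'a \<Rightarrow> real) \<Rightarrow> ('a \<Rightarrow> nat) \<Rightarrow> bool" where
  "is_bayes_estimator M p h \<longleftrightarrow>
     h \<in> measurable M (count_space {0, 1}) \<and>
     (\<forall>x\<in>space M. is_arg_max (\<lambda>z. p z x) (\<lambda>z. z \<in> {0, 1}) (h x))"

definition error_prob ::
  "'a measure \<Rightarrow> (nat \<Rightarrow> 'a \<Rightarrow> real) \<Rightarrow> ('a \<Rightarrow> nat) \<Rightarrow> real" where
  "error_prob M p h =
     1 / 2 * (\<Sum>z\<in>{0, 1}. measure (density M (p z)) {x \<in> space M. h x \<noteq> z})"

text \<open>The law of \<open>Y = (Y\<^sub>1, \<dots>, Y\<^sub>n)\<close> with independent components, where \<open>Y\<^sub>j\<close> has the tilted density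
  of \<open>p j\<close> and \<open>q j\<close>. Random variables derived from \<open>Y\<close> are functions on this probability space, with
  \<open>Y\<^sub>j\<close> the \<open>j\<close>-th coordinate.\<close>

definition tilted_law ::
  "nat \<Rightarrow> (nat \<Rightarrow> 'a measure) \<Rightarrow> (nat \<Rightarrow> 'a \<Rightarrow> real) \<Rightarrow> (nat \<Rightarrow> 'a \<Rightarrow> real) \<Rightarrow> real
    \<Rightarrow> (nat \<Rightarrow> 'a) measure" where
  "tilted_law n M p q \<alpha> =
     Pi\<^sub>M {1..n} (\<lambda>j. density (M j) (tilted_density (M j) (p j) (q j) \<alpha>))"

text \<open>\<open>Z\<^sub>j = log l\<^sub>j(Y\<^sub>j) - E[log l\<^sub>j(Y\<^sub>j)]\<close> with \<open>l\<^sub>j = p j / q j\<close>. For \<open>0 < \<alpha> < 1\<close> the variable \<open>log l\<^sub>j(Y\<^sub>j)\<close>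
  has exponential moments of both signs under the tilted law, so its moments of all orders are
  finite and the Bochner integrals that express them are genuine.\<close>

definition centered_llr ::
  "nat \<Rightarrow> (nat \<Rightarrow> 'a measure) \<Rightarrow> (nat \<Rightarrow> 'a \<Rightarrow> real) \<Rightarrow> (nat \<Rightarrow> 'a \<Rightarrow> real) \<Rightarrow> real
    \<Rightarrow> nat \<Rightarrow> (nat \<Rightarrow> 'a) \<Rightarrow> real" where
  "centered_llr n M p q \<alpha> j y =
     ln (p j (y j) / q j (y j))
     - prob_space.expectation (tilted_law n M p q \<alpha>) (\<lambda>y. ln (p j (y j) / q j (y j)))"

end

theory Submission
  imports Defs
begin

text \<open>
  Under the tilted law \<open>Q\<close> at the optimal \<open>\<alpha>\<close>, the log-likelihood ratio is a sum \<open>S\<close> of independent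
  variables, and it is centred because \<open>\<alpha>\<close> minimizes \<open>\<integral> \<phi>\<^sub>0\<^bsup>1-\<alpha>\<^esup> \<phi>\<^sub>1\<^bsup>\<alpha>\<^esup>\<close>. Pointwise
  \<open>min \<phi>\<^sub>0 \<phi>\<^sub>1 = e\<^bsup>-D\<^esup> \<phi>\<^sub>\<alpha> g\<^sub>\<alpha>(log l)\<close>, so everything reduces to estimating \<open>E g\<^sub>\<alpha>(S)\<close>, where \<open>g\<^sub>\<alpha>\<close>
  is a two-sided exponential of total width \<open>1 / (\<alpha> (1 - \<alpha>))\<close>. It is enough to know that \<open>S\<close>, with variance
  \<open>B\<^sup>2\<close>, has mass of order \<open>L / B\<close> in windows of length \<open>L\<close> between a large constant and a small multiple of
  \<open>B\<close>. In place of the Berry--Esseen theorem, windows are tested against Fejer kernels of scale \<open>L\<close>. Their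
  Fourier transforms live on \<open>[-1/L, 1/L]\<close>, where the moment hypothesis forces the characteristic function of
  \<open>S\<close> to decay on the scale \<open>1 / B\<close> and to be close to the Gaussian one for \<open>t = O(1 / B)\<close>.
\<close>

section \<open>Fejer kernels\<close>

text \<open>The moment hypothesis bounds the Lyapunov ratio of \<open>S\<close> by
  \<open>C1 / B\<close>, so the error of a normal approximation to its distribution function is of
  the same order \<open>1 / B\<close> as the mass sought in a bounded window. Windows shorter than a
  multiple of \<open>C1\<close> may be empty, since the components can be lattice variables, and the
  characteristic function is controlled only for frequencies up to \<open>1 / (4 * C1)\<close>.
  Hence windows are stretched by a factor \<open>K = max 1 (4 * C1)\<close> beyond the natural width
  of the two-sided exponential; the price depends on \<open>C1\<close> only. Band-limited kernels
  suit this restriction, but they are not compactly supported, and their inverse square tails also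
  carry mass of order \<open>L / B\<close>. A lower bound for a kernel average therefore does not by
  itself put mass into a window. The upper bound holds at every scale above \<open>4 * C1\<close>,
  so it can be used again at scale \<open>8192 * L\<close>, where it shows that the tails contribute
  only a small fraction. The factor \<open>2 ^ 51\<close> makes \<open>B\<close> so large that the
  Gaussian approximation remains accurate for window centres up to \<open>8192 * L\<close> from the
  origin.\<close>

definition fejer :: "real \<Rightarrow> real \<Rightarrow> real" where
  "fejer \<tau> x = (if x = 0 then 1 else 2 * (1 - cos (\<tau> * x)) / (\<tau> * x)\<^sup>2)"

lemma fejer_eq_sin:
  assumes "x \<noteq> 0" "\<tau> > 0"
  shows "fejer \<tau> x = (sin (\<tau> * x / 2))\<^sup>2 / (\<tau> * x / 2)\<^sup>2"
proof -
  have "cos (\<tau> * x) = 1 - 2 * (sin (\<tau> * x / 2))\<^sup>2"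
    using cos_double_sin[of "\<tau> * x / 2"] by simp
  then show ?thesis using assms by (simp add: fejer_def power2_eq_square field_simps)
qed

lemma fejer_nonneg: "fejer \<tau> x \<ge> 0"
  by (simp add: fejer_def)

lemma fejer_le_1:
  assumes "\<tau> > 0"
  shows "fejer \<tau> x \<le> 1"
proof (cases "x = 0")
  case False
  have "(sin (\<tau> * x / 2))\<^sup>2 \<le> (\<tau> * x / 2)\<^sup>2"
    using abs_sin_x_le_abs_x[of "\<tau> * x / 2"] by (simp only: abs_le_square_iff)
  then show ?thesis using False assms by (simp add: fejer_eq_sin divide_le_eq_1)
qed (simp add: fejer_def)

lemma fejer_le:
  assumes "\<tau> > 0" "x \<noteq> 0"
  shows "fejer \<tau> x \<le> 4 / (\<tau> * x)\<^sup>2"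
proof -
  have "2 * (1 - cos (\<tau> * x)) \<le> 4" using cos_ge_minus_one[of "\<tau> * x"] by argo
  then show ?thesis using assms by (simp add: fejer_def divide_right_mono)
qed

text \<open>Fourier inversion for the triangle \<open>\<tau> - \<bar>t\<bar>\<close>, folded to the
  half-line by parity. It makes the kernel band-limited: its averages see a characteristic function
  only on \<open>[0, \<tau>]\<close>.\<close>

lemma fejer_eq_integral:
  assumes "\<tau> > 0"
  shows "(\<integral>t. indicator {0..\<tau>} t * ((\<tau> - t) * cos (t * x)) \<partial>lborel) = \<tau>\<^sup>2 / 2 * fejer \<tau> x"
proof (cases "x = 0")
  case True
  have "(\<integral>t. indicator {0..\<tau>} t *\<^sub>R (\<tau> - t) \<partial>lborel) = (\<tau> * \<tau> - \<tau>\<^sup>2 / 2) - (\<tau> * 0 - 0\<^sup>2 / 2)"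
    using assms
    by (intro integral_FTC_Icc)
       (auto intro!: derivative_eq_intros continuous_intros simp: has_real_derivative_iff_has_vector_derivative[symmetric])
  with True show ?thesis by (simp add: fejer_def power2_eq_square)
next
  case False
  let ?F = "\<lambda>t. (\<tau> - t) * sin (t * x) / x - cos (t * x) / x\<^sup>2"
  have "(\<integral>t. indicator {0..\<tau>} t *\<^sub>R ((\<tau> - t) * cos (t * x)) \<partial>lborel) = ?F \<tau> - ?F 0"
    using assms False
    by (intro integral_FTC_Icc)
       (auto intro!: derivative_eq_intros continuous_intros
          simp: has_real_derivative_iff_has_vector_derivative[symmetric] field_simps power2_eq_square)
  then have "(\<integral>t. indicator {0..\<tau>} t * ((\<tau> - t) * cos (t * x)) \<partial>lborel) = (1 - cos (\<tau> * x)) / x\<^sup>2"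
    by (simp add: diff_divide_distrib)
  also have "\<dots> = \<tau>\<^sup>2 / 2 * fejer \<tau> x"
    using False assms by (simp add: fejer_def power_mult_distrib) (simp add: divide_simps)
  finally show ?thesis .
qed

text \<open>The zeros of the kernel are removed by adding a translate by half a period of \<open>sin\<^sup>2\<close>.\<close>

lemma inverse_square_le_fejer:
  assumes "L > 0"
  shows "1 / (1 + \<bar>x\<bar> / L)\<^sup>2 \<le> 4 * (fejer (1 / L) x + fejer (1 / L) (x + pi * L))"
proof -
  define y where "y = x / (2 * L)"
  \<comment> \<open>A common lower bound of \<open>1 / y\<^sup>2\<close> and
    \<open>1 / (y + pi / 2)\<^sup>2\<close>. Shifting \<open>x\<close> by \<open>pi * L\<close>
    shifts \<open>y\<close> by \<open>pi / 2\<close> and turns the sine into a cosine, so the two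
    kernels together dominate \<open>c\<close> times
    \<open>sin\<^sup>2 + cos\<^sup>2\<close>.\<close>
  define c where "c = 1 / (\<bar>y\<bar> + pi / 2)\<^sup>2"
  have pos: "\<bar>y\<bar> + pi / 2 > 0" using pi_gt_zero by linarith
  have 1: "(sin y)\<^sup>2 * c \<le> fejer (1 / L) x"
  proof (cases "x = 0")
    case False
    have "y \<noteq> 0" using False assms by (simp add: y_def)
    have "fejer (1 / L) x = (sin y)\<^sup>2 * (1 / y\<^sup>2)"
      using fejer_eq_sin[of x "1 / L"] False assms by (simp add: y_def mult.commute)
    moreover have "c \<le> 1 / y\<^sup>2" unfolding c_def
      using \<open>y \<noteq> 0\<close> pi_gt_zero by (intro divide_left_mono) (auto simp: abs_le_square_iff[symmetric] intro!: mult_pos_pos[OF zero_less_power[OF pos]])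
    ultimately show ?thesis by (simp only: mult_left_mono[OF _ zero_le_power2])
  qed (simp add: fejer_def y_def)
  have 2: "(cos y)\<^sup>2 * c \<le> fejer (1 / L) (x + pi * L)"
  proof (cases "x + pi * L = 0")
    case True
    then have "y = - (pi / 2)" using assms by (simp add: y_def field_simps)
    then show ?thesis using True by (simp add: fejer_def)
  next
    case False
    have y': "1 / L * (x + pi * L) / 2 = y + pi / 2" using assms by (simp add: y_def field_simps)
    have nz: "y + pi / 2 \<noteq> 0" using False assms by (auto simp: y_def field_simps)
    have "sin (y + pi / 2) = cos y" by (simp add: sin_add)
    then have "fejer (1 / L) (x + pi * L) = (cos y)\<^sup>2 * (1 / (y + pi / 2)\<^sup>2)"
      using fejer_eq_sin[of "x + pi * L" "1 / L"] False assms unfolding y' by simp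
    moreover have "c \<le> 1 / (y + pi / 2)\<^sup>2" unfolding c_def
      using nz pi_gt_zero abs_triangle_ineq[of y "pi / 2"] by (intro divide_left_mono) (auto simp: abs_le_square_iff[symmetric] intro!: mult_pos_pos[OF zero_less_power[OF pos]])
    ultimately show ?thesis by (simp only: mult_left_mono[OF _ zero_le_power2])
  qed
  have "c = (sin y)\<^sup>2 * c + (cos y)\<^sup>2 * c"
    by (simp add: distrib_right[symmetric])
  with 1 2 have 3: "c \<le> fejer (1 / L) x + fejer (1 / L) (x + pi * L)" by linarith
  have "2 * \<bar>y\<bar> = \<bar>x\<bar> / L" using assms by (simp add: y_def)
  moreover have "\<bar>y\<bar> + pi / 2 \<le> 2 * (1 + 2 * \<bar>y\<bar>)" using pi_less_4 abs_ge_zero[of y] by argo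
  ultimately have "\<bar>y\<bar> + pi / 2 \<le> 2 * (1 + \<bar>x\<bar> / L)" by simp
  then have "(\<bar>y\<bar> + pi / 2)\<^sup>2 \<le> (2 * (1 + \<bar>x\<bar> / L))\<^sup>2" using pos by (intro power_mono) auto
  then have "1 / (2 * (1 + \<bar>x\<bar> / L))\<^sup>2 \<le> c" unfolding c_def
    using pos assms by (intro divide_left_mono) (auto intro!: mult_pos_pos zero_less_power add_pos_nonneg)
  then have "1 / (1 + \<bar>x\<bar> / L)\<^sup>2 \<le> 4 * c" by (simp only: power_mult_distrib) simp
  with 3 show ?thesis by argo
qed

lemma fejer_measurable [measurable]: "fejer \<tau> \<in> borel_measurable borel"
  unfolding fejer_def[abs_def] by measurable

text \<open>Fubini applied to the cosine representation. The factor \<open>iexp (- (t * a))\<close>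
  is the translation by \<open>a\<close>, and the real part appears because the kernel is
  even.\<close>

lemma (in prob_space) expectation_fejer:
  assumes \<tau>: "\<tau> > 0" and [measurable]: "random_variable borel S"
  shows "expectation (\<lambda>\<omega>. fejer \<tau> (S \<omega> - a)) =
    2 / \<tau>\<^sup>2 * (\<integral>t. indicator {0..\<tau>} t * ((\<tau> - t) * Re (iexp (- (t * a)) * char (distr M borel S) t)) \<partial>lborel)"
proof -
  \<comment> \<open>On the bounded frequency range Lebesgue measure is finite, so the bound
    \<open>\<tau>\<close> on the integrand already gives integrability on the product.\<close>
  interpret U: finite_measure "restrict_space lborel {0..\<tau>}"
    by (rule finite_measureI) (use \<tau> in \<open>simp add: emeasure_restrict_space space_restrict_space\<close>)
  interpret P: pair_sigma_finite M "restrict_space lborel {0..\<tau>}"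
    by standard
  interpret P': finite_measure "M \<Otimes>\<^sub>M restrict_space lborel {0..\<tau>}"
    by (intro finite_measure_pair_measure) (auto intro: finite_measure_axioms U.finite_measure_axioms)
  let ?f = "\<lambda>\<omega> t. (\<tau> - t) * cos (t * (S \<omega> - a))"
  have [measurable]: "(\<lambda>t. t) \<in> borel_measurable (restrict_space lborel {0..\<tau>})"
    by (intro measurable_restrict_space1) simp
  have int: "integrable (M \<Otimes>\<^sub>M restrict_space lborel {0..\<tau>}) (case_prod ?f)"
  proof (rule P'.integrable_const_bound[where B = \<tau>])
    show "AE x in M \<Otimes>\<^sub>M restrict_space lborel {0..\<tau>}. norm (case x of (\<omega>, t) \<Rightarrow> ?f \<omega> t) \<le> \<tau>"
    proof (rule AE_I2)
      fix x assume "x \<in> space (M \<Otimes>\<^sub>M restrict_space lborel {0..\<tau>})"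
      then obtain \<omega> t where x: "x = (\<omega>, t)" "0 \<le> t" "t \<le> \<tau>"
        by (auto simp: space_pair_measure space_restrict_space)
      have "\<bar>(\<tau> - t) * cos (t * (S \<omega> - a))\<bar> \<le> \<tau> * 1"
        unfolding abs_mult using x by (intro mult_mono) auto
      with x show "norm (case x of (\<omega>, t) \<Rightarrow> ?f \<omega> t) \<le> \<tau>" by simp
    qed
  qed measurable
  have I: "(\<integral>t. g t \<partial>restrict_space lborel {0..\<tau>}) = (\<integral>t. indicator {0..\<tau>} t * g t \<partial>lborel)"
    for g :: "real \<Rightarrow> real"
    by (subst integral_restrict_space) auto
  have E: "(\<integral>\<omega>. cos (t * (S \<omega> - a)) \<partial>M) = Re (iexp (- (t * a)) * char (distr M borel S) t)" for t
  proof -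
    have i: "integrable M (\<lambda>\<omega>. iexp (t * S \<omega>))" by (intro integrable_iexp) auto
    have "iexp (- (t * a)) * char (distr M borel S) t = (\<integral>\<omega>. iexp (- (t * a)) * iexp (t * S \<omega>) \<partial>M)"
      by (simp add: char_def integral_distr)
    also have "\<dots> = (\<integral>\<omega>. iexp (t * (S \<omega> - a)) \<partial>M)"
      by (simp add: exp_add[symmetric] algebra_simps)
    finally have "Re (iexp (- (t * a)) * char (distr M borel S) t) = Re (\<integral>\<omega>. iexp (t * (S \<omega> - a)) \<partial>M)"
      by simp
    also have "\<dots> = (\<integral>\<omega>. Re (iexp (t * (S \<omega> - a))) \<partial>M)"
      by (intro integral_Re[symmetric] integrable_iexp) auto
    finally show ?thesis by (simp add: Re_exp)
  qed
  have "expectation (\<lambda>\<omega>. fejer \<tau> (S \<omega> - a)) =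
      (\<integral>\<omega>. 2 / \<tau>\<^sup>2 * (\<integral>t. ?f \<omega> t \<partial>restrict_space lborel {0..\<tau>}) \<partial>M)"
    unfolding I fejer_eq_integral[OF \<tau>] using \<tau> by simp
  also have "\<dots> = 2 / \<tau>\<^sup>2 * (\<integral>\<omega>. (\<integral>t. ?f \<omega> t \<partial>restrict_space lborel {0..\<tau>}) \<partial>M)"
    by simp
  also have "(\<integral>\<omega>. (\<integral>t. ?f \<omega> t \<partial>restrict_space lborel {0..\<tau>}) \<partial>M) =
     (\<integral>t. (\<integral>\<omega>. ?f \<omega> t \<partial>M) \<partial>restrict_space lborel {0..\<tau>})"
    by (rule P.Fubini_integral[symmetric, OF int])
  also have "\<dots> = (\<integral>t. indicator {0..\<tau>} t * ((\<tau> - t) * Re (iexp (- (t * a)) * char (distr M borel S) t)) \<partial>lborel)"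
    by (subst I) (simp add: E)
  finally show ?thesis .
qed

section \<open>Characteristic functions of independent sums\<close>

text \<open>Below the threshold \<open>e\<close> the square is at most \<open>e\<^sup>2\<close>;
  above it a factor \<open>e\<close> can be traded for \<open>\<bar>y\<bar>\<close>. This is how
  second moments are bounded by third ones.\<close>

lemma square_le_cube:
  fixes y e :: real
  assumes "e > 0"
  shows "y\<^sup>2 \<le> e\<^sup>2 + \<bar>y\<bar> ^ 3 / e"
proof (cases "\<bar>y\<bar> \<le> e")
  case True
  then have "y\<^sup>2 \<le> e\<^sup>2" by (rule power2_le_iff_abs_le[THEN iffD2, rotated]) (use assms in simp)
  moreover have "\<bar>y\<bar> ^ 3 / e \<ge> 0" using assms by simp
  ultimately show ?thesis by linarith
next
  case False
  have "y\<^sup>2 * e \<le> y\<^sup>2 * \<bar>y\<bar>" using False by (intro mult_left_mono) auto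
  also have "\<dots> = \<bar>y\<bar> ^ 3" by (simp add: power2_eq_square power3_eq_cube abs_mult[symmetric])
  finally have "y\<^sup>2 \<le> \<bar>y\<bar> ^ 3 / e" using assms by (simp add: field_simps)
  then show ?thesis by (simp add: add_increasing)
qed

lemma exp_minus_approx:
  fixes y :: real
  assumes "y \<ge> 0"
  shows "\<bar>exp (- y) - (1 - y)\<bar> \<le> y\<^sup>2 / 2"
proof -
  have "exp (- y) \<ge> 1 - y" using exp_ge_add_one_self[of "- y"] by simp
  moreover have "exp (- y) \<le> 1 - y + y\<^sup>2 / 2"
  proof -
    define f where "f = (\<lambda>y::real. 1 - y + y\<^sup>2 / 2 - exp (- y))"
    have "f 0 \<le> f y"
    proof (rule DERIV_nonneg_imp_nondecreasing[OF assms])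
      fix x :: real
      have "(f has_real_derivative (- 1 + x + exp (- x))) (at x)"
        unfolding f_def by (auto intro!: derivative_eq_intros)
      moreover have "- 1 + x + exp (- x) \<ge> 0" using exp_ge_add_one_self[of "- x"] by simp
      ultimately show "\<exists>D. (f has_real_derivative D) (at x) \<and> 0 \<le> D" by blast
    qed
    then show ?thesis by (simp add: f_def)
  qed
  ultimately show ?thesis by simp
qed

text \<open>\<open>C\<close> has the dimension of a length, as it bounds a ratio of third to second
  moments. Frequencies up to order \<open>1 / C\<close> are under control, and \<open>C / B\<close>
  bounds the Lyapunov ratio.\<close>

locale independent_sum = prob_space +
  fixes X :: "'i \<Rightarrow> 'a \<Rightarrow> real" and I :: "'i set" and B C :: real
  assumes finite_I: "finite I"
    and indep: "indep_vars (\<lambda>_. borel) X I"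
    and integrable_cube: "i \<in> I \<Longrightarrow> integrable M (\<lambda>\<omega>. \<bar>X i \<omega>\<bar> ^ 3)"
    and mean_zero: "i \<in> I \<Longrightarrow> expectation (X i) = 0"
    and B_pos: "B > 0" and C_pos: "C > 0"
    and sum_variance: "(\<Sum>i\<in>I. expectation (\<lambda>\<omega>. (X i \<omega>)\<^sup>2)) = B\<^sup>2"
    and sum_cube: "(\<Sum>i\<in>I. expectation (\<lambda>\<omega>. \<bar>X i \<omega>\<bar> ^ 3)) \<le> C * B\<^sup>2"
begin

definition v :: "'i \<Rightarrow> real" where "v i = expectation (\<lambda>\<omega>. (X i \<omega>)\<^sup>2)"
definition b :: "'i \<Rightarrow> real" where "b i = expectation (\<lambda>\<omega>. \<bar>X i \<omega>\<bar> ^ 3)"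
definition S :: "'a \<Rightarrow> real" where "S \<omega> = (\<Sum>i\<in>I. X i \<omega>)"
definition cf :: "real \<Rightarrow> complex" where "cf = char (distr M borel S)"

lemma measurable_X: "i \<in> I \<Longrightarrow> random_variable borel (X i)"
  using indep unfolding indep_vars_def2 by auto

lemma measurable_S [measurable]: "random_variable borel S"
  unfolding S_def[abs_def] using measurable_X by auto

lemma
  assumes "i \<in> I"
  shows integrable_square: "integrable M (\<lambda>\<omega>. (X i \<omega>)\<^sup>2)"
    and integrable_X: "integrable M (X i)"
proof -
  note [measurable] = measurable_X[OF assms]
  show sq: "integrable M (\<lambda>\<omega>. (X i \<omega>)\<^sup>2)"
  proof (rule Bochner_Integration.integrable_bound)
    show "integrable M (\<lambda>\<omega>. 1 + \<bar>X i \<omega>\<bar> ^ 3)" using integrable_cube[OF assms] by auto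
    show "AE \<omega> in M. norm ((X i \<omega>)\<^sup>2) \<le> norm (1 + \<bar>X i \<omega>\<bar> ^ 3)"
      using square_le_cube[of 1] by (auto simp: abs_of_nonneg add_nonneg_nonneg)
  qed measurable
  show "integrable M (X i)"
    by (rule square_integrable_imp_integrable[OF _ sq]) measurable
qed

lemma v_nonneg: "v i \<ge> 0" and b_nonneg: "b i \<ge> 0"
  by (simp_all add: v_def b_def)

text \<open>Two choices of \<open>e\<close> matter: with \<open>e = 1\<close> the third moment
  outweighs a large \<open>v i * t\<^sup>2\<close>, and with a small \<open>e\<close> every single
  \<open>v i * t\<^sup>2\<close> is seen to be small.\<close>

lemma v_le:
  assumes "i \<in> I" "e > 0"
  shows "v i * t\<^sup>2 \<le> e\<^sup>2 + \<bar>t\<bar> ^ 3 * b i / e"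
proof -
  have "v i * t\<^sup>2 = expectation (\<lambda>\<omega>. (X i \<omega> * t)\<^sup>2)" by (simp add: v_def power_mult_distrib)
  also have "\<dots> \<le> expectation (\<lambda>\<omega>. e\<^sup>2 + \<bar>X i \<omega>\<bar> ^ 3 * (\<bar>t\<bar> ^ 3 / e))"
    using integrable_cube[OF assms(1)] integrable_square[OF assms(1)] square_le_cube[OF assms(2), of "X i _ * t"]
    by (intro integral_mono) (auto simp: power_mult_distrib abs_mult)
  also have "\<dots> = e\<^sup>2 + b i * (\<bar>t\<bar> ^ 3 / e)"
    using integrable_cube[OF assms(1)] by (subst Bochner_Integration.integral_add) (auto simp: b_def prob_space)
  finally show ?thesis by (simp add: mult.commute)
qed

lemma char_X_approx:
  assumes "i \<in> I"
  shows "cmod (char (distr M borel (X i)) t - (1 - t\<^sup>2 * v i / 2)) \<le> \<bar>t\<bar> ^ 3 * b i / 6"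
proof -
  note [measurable] = measurable_X[OF assms]
  have "cmod (char (distr M borel (X i)) t - (1 - t\<^sup>2 * v i / 2)) \<le>
      (t\<^sup>2 / 6) * expectation (\<lambda>\<omega>. min (6 * (X i \<omega>)\<^sup>2) (\<bar>t\<bar> * \<bar>X i \<omega>\<bar> ^ 3))"
    by (rule char_approx3') (auto simp: v_def mean_zero assms integrable_square integrable_X)
  also have "\<dots> \<le> (t\<^sup>2 / 6) * expectation (\<lambda>\<omega>. \<bar>t\<bar> * \<bar>X i \<omega>\<bar> ^ 3)"
    using integrable_cube[OF assms] integrable_square[OF assms]
    by (intro mult_left_mono integral_mono) auto
  also have "\<dots> = \<bar>t\<bar> ^ 3 * b i / 6"
    by (simp add: b_def power3_eq_cube power2_eq_square abs_mult[symmetric])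
  finally show ?thesis .
qed

lemma char_X_le_1: "i \<in> I \<Longrightarrow> cmod (char (distr M borel (X i)) t) \<le> 1"
  by (intro real_distribution.cmod_char_le_1 real_distribution_distr measurable_X)

lemma cf_eq_prod: "cf t = (\<Prod>i\<in>I. char (distr M borel (X i)) t)"
  unfolding cf_def S_def[abs_def] by (rule char_distr_sum[OF indep])

text \<open>If \<open>t\<^sup>2 * v i \<le> 2\<close>, the quadratic Taylor polynomial is
  nonnegative and \<open>1 + u \<le> exp u\<close> applies. Otherwise \<open>v_le\<close> makes the
  exponent on the right nonnegative, and the trivial bound 1 is enough.\<close>

lemma cmod_char_X_le:
  assumes "i \<in> I"
  shows "cmod (char (distr M borel (X i)) t) \<le> exp (\<bar>t\<bar> ^ 3 * b i - t\<^sup>2 * v i / 2)"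
proof (cases "t\<^sup>2 * v i \<le> 2")
  case True
  have "cmod (char (distr M borel (X i)) t) \<le>
      cmod (1 - t\<^sup>2 * v i / 2) + cmod (char (distr M borel (X i)) t - (1 - t\<^sup>2 * v i / 2))"
    by (metis norm_triangle_sub)
  also have "cmod (1 - t\<^sup>2 * v i / 2) = \<bar>1 - t\<^sup>2 * v i / 2\<bar>"
    by (metis norm_of_real of_real_1 of_real_diff of_real_divide of_real_mult of_real_numeral of_real_power)
  also have "\<dots> = 1 - t\<^sup>2 * v i / 2" using True by simp
  also have "cmod (char (distr M borel (X i)) t - (1 - t\<^sup>2 * v i / 2)) \<le> \<bar>t\<bar> ^ 3 * b i"
    by (rule order.trans[OF char_X_approx[OF assms]]) (simp add: b_nonneg)
  also have "1 - t\<^sup>2 * v i / 2 + \<bar>t\<bar> ^ 3 * b i \<le> exp (\<bar>t\<bar> ^ 3 * b i - t\<^sup>2 * v i / 2)"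
    using exp_ge_add_one_self[of "\<bar>t\<bar> ^ 3 * b i - t\<^sup>2 * v i / 2"] by linarith
  finally show ?thesis by simp
next
  case False
  then have "0 \<le> \<bar>t\<bar> ^ 3 * b i - t\<^sup>2 * v i / 2"
    using v_le[OF assms, of 1 t] by (simp add: mult.commute)
  then have "1 \<le> exp (\<bar>t\<bar> ^ 3 * b i - t\<^sup>2 * v i / 2)" by simp
  then show ?thesis using char_X_le_1[OF assms, of t] by linarith
qed

text \<open>In this range of \<open>t\<close> the cubic term uses up at most half of the quadratic
  one, so \<open>exp (- (B * t / 2)\<^sup>2)\<close> remains. It is weakened to a rational function,
  which has an elementary antiderivative.\<close>

lemma cmod_cf_le:
  assumes "\<bar>t\<bar> * (4 * C) \<le> 1"
  shows "cmod (cf t) \<le> 1 / (1 + (B * t / 2)\<^sup>2)"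
proof -
  have "cmod (cf t) = (\<Prod>i\<in>I. cmod (char (distr M borel (X i)) t))"
    by (simp add: cf_eq_prod prod_norm)
  also have "\<dots> \<le> (\<Prod>i\<in>I. exp (\<bar>t\<bar> ^ 3 * b i - t\<^sup>2 * v i / 2))"
    by (intro prod_mono conjI cmod_char_X_le) auto
  also have "\<dots> = exp (\<bar>t\<bar> ^ 3 * (\<Sum>i\<in>I. b i) - t\<^sup>2 * (\<Sum>i\<in>I. v i) / 2)"
    by (simp add: exp_sum[OF finite_I, symmetric] sum_subtractf sum_distrib_left sum_divide_distrib)
  also have "\<dots> \<le> exp (- (B * t / 2)\<^sup>2)"
  proof -
    have "\<bar>t\<bar> ^ 3 * (\<Sum>i\<in>I. b i) \<le> \<bar>t\<bar> ^ 3 * (C * B\<^sup>2)"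
      using sum_cube by (intro mult_left_mono) (auto simp: b_def)
    also have "\<dots> = (\<bar>t\<bar> * (4 * C)) * (B * t / 2)\<^sup>2"
      by (simp add: power_mult_distrib power3_eq_cube power2_eq_square)
    also have "\<dots> \<le> 1 * (B * t / 2)\<^sup>2" using assms by (intro mult_right_mono) auto
    finally have "\<bar>t\<bar> ^ 3 * (\<Sum>i\<in>I. b i) \<le> (B * t / 2)\<^sup>2" by simp
    moreover have "t\<^sup>2 * (\<Sum>i\<in>I. v i) / 2 = 2 * (B * t / 2)\<^sup>2"
      using sum_variance by (simp add: v_def power2_eq_square)
    ultimately show ?thesis by simp
  qed
  also have "\<dots> \<le> 1 / (1 + (B * t / 2)\<^sup>2)"
    using exp_ge_add_one_self[of "(B * t / 2)\<^sup>2"]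
    by (simp add: exp_minus inverse_eq_divide add_pos_nonneg divide_left_mono)
  finally show ?thesis .
qed

text \<open>Truncating at \<open>e\<close> in \<open>v_le\<close> makes all the individual variances negligible, without a
  Lyapunov inequality.\<close>

lemma cf_approx:
  assumes "e > 0"
  shows "cmod (cf t - exp (- (B * t)\<^sup>2 / 2)) \<le>
    \<bar>t\<bar> ^ 3 * (C * B\<^sup>2) / 6 + (B * t)\<^sup>2 * (e\<^sup>2 + \<bar>t\<bar> ^ 3 * (C * B\<^sup>2) / e) / 8"
proof -
  let ?m = "e\<^sup>2 + \<bar>t\<bar> ^ 3 * (C * B\<^sup>2) / e"
  let ?f = "\<lambda>i. char (distr M borel (X i)) t"
  let ?g = "\<lambda>i. complex_of_real (exp (- (t\<^sup>2 * v i / 2)))"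
  have b_le: "b i \<le> C * B\<^sup>2" if "i \<in> I" for i
    using member_le_sum[OF that, of b] finite_I sum_cube b_nonneg by (auto simp: b_def)
  have 1: "cmod (?f i - ?g i) \<le> \<bar>t\<bar> ^ 3 / 6 * b i + t\<^sup>2 / 8 * ?m * v i" if i: "i \<in> I" for i
  proof -
    let ?y = "t\<^sup>2 * v i / 2"
    have y: "?y \<ge> 0" by (simp add: v_nonneg)
    have "?g i - (1 - t\<^sup>2 * v i / 2) = complex_of_real (exp (- ?y) - (1 - ?y))" by simp
    then have "cmod (?g i - (1 - t\<^sup>2 * v i / 2)) \<le> ?y\<^sup>2 / 2"
      using exp_minus_approx[OF y] by (simp only: norm_of_real)
    \<comment> \<open>One factor \<open>v i\<close> is kept, to be summed to
      \<open>B\<^sup>2\<close>; the other is replaced by the uniform bound.\<close>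
    also have "\<dots> = t\<^sup>2 / 8 * (v i * t\<^sup>2) * v i" by (simp add: power2_eq_square)
    also have "\<dots> \<le> t\<^sup>2 / 8 * ?m * v i"
    proof (intro mult_right_mono mult_left_mono v_nonneg)
      have "\<bar>t\<bar> ^ 3 * b i / e \<le> \<bar>t\<bar> ^ 3 * (C * B\<^sup>2) / e"
        using b_le[OF i] assms by (intro divide_right_mono mult_left_mono) auto
      then show "v i * t\<^sup>2 \<le> ?m" using v_le[OF i assms, of t] by linarith
    qed auto
    finally have "cmod (?g i - (1 - t\<^sup>2 * v i / 2)) \<le> t\<^sup>2 / 8 * ?m * v i" .
    moreover have "cmod (?f i - ?g i) \<le> cmod (?f i - (1 - t\<^sup>2 * v i / 2)) + cmod (?g i - (1 - t\<^sup>2 * v i / 2))"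
      using norm_triangle_ineq4[of "?f i - (1 - t\<^sup>2 * v i / 2)" "?g i - (1 - t\<^sup>2 * v i / 2)"] by simp
    ultimately show ?thesis using char_X_approx[OF i, of t] by argo
  qed
  have "(\<Prod>i\<in>I. ?g i) = complex_of_real (exp (\<Sum>i\<in>I. - (t\<^sup>2 * v i / 2)))"
    by (simp add: exp_sum finite_I)
  also have "(\<Sum>i\<in>I. - (t\<^sup>2 * v i / 2)) = - (B * t)\<^sup>2 / 2"
    using sum_variance by (simp add: v_def sum_negf sum_divide_distrib[symmetric] sum_distrib_left[symmetric] power_mult_distrib)
  finally have "cmod (cf t - exp (- (B * t)\<^sup>2 / 2)) = cmod ((\<Prod>i\<in>I. ?f i) - (\<Prod>i\<in>I. ?g i))"
    by (simp add: cf_eq_prod)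
  \<comment> \<open>Telescoping: all factors of both products lie in the closed unit disc.\<close>
  also have "\<dots> \<le> (\<Sum>i\<in>I. cmod (?f i - ?g i))"
    by (rule norm_prod_diff) (auto simp: char_X_le_1 v_nonneg norm_of_real simp del: of_real_exp)
  also have "\<dots> \<le> (\<Sum>i\<in>I. \<bar>t\<bar> ^ 3 / 6 * b i + t\<^sup>2 / 8 * ?m * v i)"
    by (intro sum_mono 1)
  also have "\<dots> = \<bar>t\<bar> ^ 3 / 6 * (\<Sum>i\<in>I. b i) + t\<^sup>2 / 8 * ?m * (\<Sum>i\<in>I. v i)"
    by (simp add: sum.distrib sum_distrib_left)
  also have "\<dots> \<le> \<bar>t\<bar> ^ 3 / 6 * (C * B\<^sup>2) + t\<^sup>2 / 8 * ?m * B\<^sup>2"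
    using sum_cube sum_variance by (intro add_mono mult_left_mono) (use assms C_pos in \<open>auto simp: v_def b_def\<close>)
  finally show ?thesis by (simp add: power_mult_distrib mult_ac)
qed

subsection \<open>Local mass estimates\<close>

lemma cmod_cf_le_1: "cmod (cf t) \<le> 1"
  unfolding cf_def by (intro real_distribution.cmod_char_le_1 real_distribution_distr measurable_S)

lemma cf_measurable [measurable]: "cf \<in> borel_measurable borel"
  unfolding cf_def by (intro real_distribution.char_measurable real_distribution_distr measurable_S)

lemma abs_Re_rotated_cf_le: "\<bar>Re (iexp x * cf t)\<bar> \<le> cmod (cf t)"
  by (rule order.trans[OF abs_Re_le_cmod]) (simp add: norm_mult)

text \<open>The triangle is bounded by its height \<open>1 / L\<close> and \<open>cf\<close> by its
  rational majorant, whose integral is an arctangent and hence of order \<open>1 / B\<close> however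
  \<open>B\<close> compares with \<open>L\<close>.\<close>

lemma expectation_fejer_le:
  assumes "L > 0" "L \<ge> 4 * C"
  shows "expectation (\<lambda>\<omega>. fejer (1 / L) (S \<omega> - a)) \<le> 2 * pi * L / B"
proof -
  define \<tau> where "\<tau> = 1 / L"
  have \<tau>: "\<tau> > 0" using assms by (simp add: \<tau>_def)
  let ?h = "\<lambda>t. indicator {0..\<tau>} t *\<^sub>R (\<tau> * (1 / (1 + (B * t / 2)\<^sup>2)))"
  have cont: "continuous_on {0..\<tau>} (\<lambda>t. \<tau> * (1 / (1 + (B * t / 2)\<^sup>2)))"
    by (intro continuous_intros ballI add_pos_nonneg[THEN less_imp_neq, symmetric]) auto
  have "(\<integral>t. indicator {0..\<tau>} t * ((\<tau> - t) * Re (iexp (- (t * a)) * cf t)) \<partial>lborel) \<le> (\<integral>t. ?h t \<partial>lborel)"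
  proof (rule integral_mono')
    show "integrable lborel ?h"
      using borel_integrable_compact[OF compact_Icc cont] by (simp add: indicator_def if_distrib cong: if_cong)
    fix t :: real
    have "1 + (B * t / 2)\<^sup>2 > 0" by (intro add_pos_nonneg) auto
    then show "0 \<le> ?h t" using \<tau> by simp
    show "indicator {0..\<tau>} t * ((\<tau> - t) * Re (iexp (- (t * a)) * cf t)) \<le> ?h t"
    proof (cases "t \<in> {0..\<tau>}")
      case True
      have "t * (4 * C) \<le> \<tau> * L" using True assms C_pos by (intro mult_mono) auto
      then have "\<bar>t\<bar> * (4 * C) \<le> 1" using True assms by (simp add: \<tau>_def)
      then have "\<bar>Re (iexp (- (t * a)) * cf t)\<bar> \<le> 1 / (1 + (B * t / 2)\<^sup>2)"
        using abs_Re_rotated_cf_le[of "- (t * a)" t] cmod_cf_le by (meson order.trans)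
      then have "(\<tau> - t) * Re (iexp (- (t * a)) * cf t) \<le> (\<tau> - t) * (1 / (1 + (B * t / 2)\<^sup>2))"
        using True by (intro mult_left_mono) auto
      also have "\<dots> \<le> \<tau> * (1 / (1 + (B * t / 2)\<^sup>2))"
        using True \<open>1 + (B * t / 2)\<^sup>2 > 0\<close> by (intro mult_right_mono) auto
      finally show ?thesis using True by simp
    qed simp
  qed
  also have "(\<integral>t. ?h t \<partial>lborel) = \<tau> * (2 / B) * arctan (B * \<tau> / 2) - \<tau> * (2 / B) * arctan (B * 0 / 2)"
  proof (rule integral_FTC_Icc)
    fix t :: real
    have "1 + (B * t / 2)\<^sup>2 > 0" by (intro add_pos_nonneg) auto
    then have "((\<lambda>t. \<tau> * (2 / B) * arctan (B * t / 2)) has_real_derivative \<tau> * (1 / (1 + (B * t / 2)\<^sup>2))) (at t within {0..\<tau>})"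
      using B_pos by (auto intro!: derivative_eq_intros simp: inverse_eq_divide) (simp add: divide_simps)
    then show "((\<lambda>t. \<tau> * (2 / B) * arctan (B * t / 2)) has_vector_derivative \<tau> * (1 / (1 + (B * t / 2)\<^sup>2))) (at t within {0..\<tau>})"
      by (simp only: has_real_derivative_iff_has_vector_derivative)
  qed (use \<tau> cont in auto)
  also have "\<dots> \<le> \<tau> * (2 / B) * (pi / 2)"
    using arctan_ubound[of "B * \<tau> / 2"] \<tau> B_pos by (simp add: divide_right_mono mult_left_mono)
  finally have "(\<integral>t. indicator {0..\<tau>} t * ((\<tau> - t) * Re (iexp (- (t * a)) * cf t)) \<partial>lborel) \<le> \<tau> * pi / B" by simp
  then have "2 / \<tau>\<^sup>2 * (\<integral>t. indicator {0..\<tau>} t * ((\<tau> - t) * Re (iexp (- (t * a)) * cf t)) \<partial>lborel) \<le> 2 / \<tau>\<^sup>2 * (\<tau> * pi / B)"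
    by (rule mult_left_mono) simp
  also have "\<dots> = 2 * pi * L / B" using assms by (simp add: \<tau>_def power2_eq_square)
  finally show ?thesis
    using expectation_fejer[OF \<tau> measurable_S, of a] unfolding cf_def[symmetric] by (simp add: \<tau>_def)
qed

lemma integrable_fejer: "\<tau> > 0 \<Longrightarrow> integrable M (\<lambda>\<omega>. fejer \<tau> (S \<omega> - a))"
  by (rule integrable_const_bound[of _ 1]) (auto simp: fejer_le_1 fejer_nonneg)

text \<open>Bounds the mass near any point at scale \<open>L\<close>, with enough tail to dominate
  both the two-sided exponentials and the tails of the kernels themselves. Uniformity in
  \<open>a\<close> of the kernel bound absorbs the translate by \<open>pi * L\<close>.\<close>

lemma expectation_inverse_square_le:
  assumes "L > 0" "L \<ge> 4 * C"
  shows "expectation (\<lambda>\<omega>. 1 / (1 + \<bar>S \<omega> - a\<bar> / L)\<^sup>2) \<le> 16 * pi * L / B"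
proof -
  have \<tau>: "1 / L > 0" using assms by simp
  have "expectation (\<lambda>\<omega>. 1 / (1 + \<bar>S \<omega> - a\<bar> / L)\<^sup>2) \<le>
      expectation (\<lambda>\<omega>. 4 * (fejer (1 / L) (S \<omega> - a) + fejer (1 / L) (S \<omega> - (a - pi * L))))"
  proof (rule integral_mono')
    fix \<omega>
    show "1 / (1 + \<bar>S \<omega> - a\<bar> / L)\<^sup>2 \<le> 4 * (fejer (1 / L) (S \<omega> - a) + fejer (1 / L) (S \<omega> - (a - pi * L)))"
      using inverse_square_le_fejer[OF assms(1), of "S \<omega> - a"] by (simp add: algebra_simps)
  qed (auto intro!: Bochner_Integration.integrable_add integrable_mult_right integrable_fejer
        simp: assms fejer_nonneg)
  also have "\<dots> = 4 * (expectation (\<lambda>\<omega>. fejer (1 / L) (S \<omega> - a)) + expectation (\<lambda>\<omega>. fejer (1 / L) (S \<omega> - (a - pi * L))))"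
    using integrable_fejer[OF \<tau>] by simp
  also have "\<dots> \<le> 4 * (2 * pi * L / B + 2 * pi * L / B)"
    by (intro mult_left_mono add_mono expectation_fejer_le assms) auto
  finally show ?thesis by (simp add: mult_ac)
qed

text \<open>The hypotheses give \<open>C / B \<le> 1 / 2 ^ 53\<close>, so for
  \<open>B * t \<le> 2 ^ 6\<close> the cubic quantity is at most \<open>2 ^ 18 / 2 ^ 53\<close>. The
  distance to the Gaussian and the effect of the rotation then each stay below
  \<open>1 / 2 ^ 12\<close>.\<close>

lemma Re_rotated_cf_ge:
  assumes L: "L > 0" "L \<ge> 4 * C" and B: "B \<ge> 2 ^ 51 * L" and a: "\<bar>a\<bar> \<le> 8192 * L"
    and t: "0 \<le> t" "t \<le> 64 / B"
  shows "Re (iexp (- (t * a)) * cf t) \<ge> exp (- (B * t)\<^sup>2 / 2) - 1 / 1024"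
proof -
  let ?g = "exp (- (B * t)\<^sup>2 / 2)" and ?w = "iexp (- (t * a))"
  have Bt: "0 \<le> B * t" "B * t \<le> 64" using t B_pos by (auto simp: field_simps)
  have "\<bar>t\<bar> ^ 3 * (C * B\<^sup>2) = (B * t) ^ 3 * (C / B)"
    using t B_pos by (simp add: power3_eq_cube power2_eq_square)
  also have "\<dots> \<le> 64 ^ 3 * (1 / 2 ^ 53)"
    using Bt B_pos C_pos L B by (intro mult_mono power_mono) (auto simp: field_simps)
  finally have 1: "\<bar>t\<bar> ^ 3 * (C * B\<^sup>2) \<le> 1 / 2 ^ 35" by simp
  \<comment> \<open>The truncation level \<open>1 / 2 ^ 11\<close> nearly balances the two terms in
    the bracket, which become \<open>1 / 2 ^ 22\<close> and at most
    \<open>1 / 2 ^ 24\<close>.\<close>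
  have "cmod (cf t - ?g) \<le>
      \<bar>t\<bar> ^ 3 * (C * B\<^sup>2) / 6 + (B * t)\<^sup>2 * ((1 / 2 ^ 11)\<^sup>2 + \<bar>t\<bar> ^ 3 * (C * B\<^sup>2) / (1 / 2 ^ 11)) / 8"
    by (rule cf_approx) simp
  also have "\<dots> \<le> (1 / 2 ^ 35) / 6 + 64\<^sup>2 * ((1 / 2 ^ 11)\<^sup>2 + (1 / 2 ^ 35) / (1 / 2 ^ 11)) / 8"
    using Bt C_pos by (intro add_mono divide_right_mono mult_mono power_mono 1 order.refl) auto
  also have "\<dots> \<le> 1 / 2 ^ 12" by (simp add: power_divide)
  finally have 2: "cmod (cf t - ?g) \<le> 1 / 2 ^ 12" .
  have "cmod (?w - 1) \<le> \<bar>t * a\<bar>" using iexp_approx1[of "- (t * a)" 0] by simp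
  also have "\<dots> \<le> 64 / B * (8192 * L)" unfolding abs_mult using t a B_pos by (intro mult_mono) auto
  also have "\<dots> \<le> 1 / 2 ^ 12" using B B_pos by (simp add: field_simps)
  finally have 3: "cmod (?w - 1) \<le> 1 / 2 ^ 12" .
  have "cmod (?w * cf t - ?g) \<le> cmod (?w * (cf t - ?g)) + cmod ((?w - 1) * ?g)"
    using norm_triangle_ineq[of "?w * (cf t - ?g)" "(?w - 1) * ?g"] by (simp add: algebra_simps)
  also have "cmod (?w * (cf t - ?g)) = cmod (cf t - ?g)" by (simp add: norm_mult)
  also have "cmod ((?w - 1) * ?g) \<le> cmod (?w - 1) * 1"
    unfolding norm_mult norm_of_real by (intro mult_left_mono) auto
  finally have "cmod (?w * cf t - ?g) \<le> 1 / 1024" using 2 3 by simp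
  then have "\<bar>Re (?w * cf t - ?g)\<bar> \<le> 1 / 1024" using abs_Re_le_cmod order.trans by blast
  then have "\<bar>Re (?w * cf t) - ?g\<bar> \<le> 1 / 1024" by (simp only: minus_complex.simps Re_complex_of_real)
  then show ?thesis unfolding abs_le_iff by linarith
qed

lemma expectation_fejer_ge:
  assumes L: "L > 0" "L \<ge> 4 * C" and B: "B \<ge> 2 ^ 51 * L" and a: "\<bar>a\<bar> \<le> 8192 * L"
  shows "expectation (\<lambda>\<omega>. fejer (1 / L) (S \<omega> - a)) \<ge> L / (4 * B)"
proof -
  define \<tau> where "\<tau> = 1 / L"
  have \<tau>: "\<tau> > 0" using L by (simp add: \<tau>_def)
  have R: "64 / B \<le> \<tau> / 2" using B B_pos L by (simp add: \<tau>_def field_simps)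
  have B1: "1 / B < 64 / B" using B_pos by (simp add: divide_strict_right_mono)
  define p where "p = (\<lambda>t. Re (iexp (- (t * a)) * cf t))"
  have [measurable]: "p \<in> borel_measurable borel" unfolding p_def by measurable
  have p_near: "p t \<ge> exp (- (B * t)\<^sup>2 / 2) - 1 / 1024" if "0 \<le> t" "t \<le> 64 / B" for t
    unfolding p_def by (rule Re_rotated_cf_ge[OF assms that])
  have p_eq: "Re (iexp (- (t * a)) * cf t) = p t" for t by (simp only: p_def)
  have p_abs: "\<bar>p t\<bar> \<le> cmod (cf t)" for t
    unfolding p_def by (rule abs_Re_rotated_cf_le)
  txt \<open>The integrand is at least of order \<open>\<tau>\<close> up to \<open>1 / B\<close>, hardly negative up to \<open>64 / B\<close> by the Gaussian
    approximation, and beyond that small by the decay of \<open>cf\<close>.\<close>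
  let ?q = "\<lambda>t. indicator {64 / B..\<tau>} t *\<^sub>R (4 * \<tau> / (B * t)\<^sup>2)"
  let ?k = "\<lambda>t. indicator {0..1 / B} t * (\<tau> / 4) - indicator {0..64 / B} t * (\<tau> / 1024) - ?q t"
  have cont: "continuous_on {64 / B..\<tau>} (\<lambda>t. 4 * \<tau> / (B * t)\<^sup>2)"
    using B_pos B1 by (intro continuous_intros) (auto simp: divide_le_0_iff)
  have int_q: "integrable lborel ?q"
    using borel_integrable_compact[OF compact_Icc cont] by (simp add: indicator_def if_distrib cong: if_cong)
  have "(\<integral>t. ?q t \<partial>lborel) = - (4 * \<tau> / B\<^sup>2) / \<tau> - - (4 * \<tau> / B\<^sup>2) / (64 / B)"
  proof (rule integral_FTC_Icc)
    fix t :: real assume "64 / B \<le> t" "t \<le> \<tau>"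
    moreover have "64 / B > 0" using B_pos by simp
    ultimately have "t > 0" by linarith
    then have "((\<lambda>t. - (4 * \<tau> / B\<^sup>2) / t) has_real_derivative 4 * \<tau> / (B * t)\<^sup>2) (at t within {64 / B..\<tau>})"
      using B_pos by (auto intro!: derivative_eq_intros simp: power2_eq_square)
    then show "((\<lambda>t. - (4 * \<tau> / B\<^sup>2) / t) has_vector_derivative 4 * \<tau> / (B * t)\<^sup>2) (at t within {64 / B..\<tau>})"
      by (simp only: has_real_derivative_iff_has_vector_derivative)
  qed (use R \<tau> cont in auto)
  also have "\<dots> \<le> \<tau> / (16 * B)" using \<tau> B_pos by (simp add: field_simps power2_eq_square)
  finally have q: "(\<integral>t. ?q t \<partial>lborel) \<le> \<tau> / (16 * B)" .
  have ind: "integrable lborel (\<lambda>t. indicator {0..c} t * d)" for c d :: real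
    by (intro integrable_mult_left integrable_real_indicator) (auto simp: emeasure_lborel_Icc_eq)
  \<comment> \<open>In units of \<open>\<tau> / B\<close> the gain is 1/4 and the two losses are
    \<open>64 / 1024\<close> and at most \<open>4 / 64\<close>, so 1/8 is left. The cut at
    \<open>64 / B\<close> is chosen to keep the second loss this small.\<close>
  have "\<tau> / (8 * B) \<le> \<tau> / 4 * (1 / B) - \<tau> / 1024 * (64 / B) - (\<integral>t. ?q t \<partial>lborel)"
    using q by (simp add: field_simps)
  also have "\<dots> = (\<integral>t. ?k t \<partial>lborel)"
    unfolding Bochner_Integration.integral_diff[OF Bochner_Integration.integrable_diff[OF ind ind] int_q]
      Bochner_Integration.integral_diff[OF ind ind]
    using B_pos by simp
  also have "\<dots> \<le> (\<integral>t. indicator {0..\<tau>} t * ((\<tau> - t) * p t) \<partial>lborel)"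
  proof (rule integral_mono)
    show "integrable lborel ?k"
      by (intro Bochner_Integration.integrable_diff ind int_q)
    show "integrable lborel (\<lambda>t. indicator {0..\<tau>} t * ((\<tau> - t) * p t))"
    proof (rule Bochner_Integration.integrable_bound[where f = "\<lambda>t. indicator {0..\<tau>} t * \<tau>"])
      show "AE t in lborel. norm (indicator {0..\<tau>} t * ((\<tau> - t) * p t)) \<le> norm (indicator {0..\<tau>} t * \<tau>)"
      proof (rule AE_I2)
        fix t
        show "norm (indicator {0..\<tau>} t * ((\<tau> - t) * p t)) \<le> norm (indicator {0..\<tau>} t * \<tau>)"
        proof (cases "t \<in> {0..\<tau>}")
          case True
          have "\<bar>p t\<bar> \<le> 1" using p_abs cmod_cf_le_1 order.trans by blast
          then have "\<bar>\<tau> - t\<bar> * \<bar>p t\<bar> \<le> \<tau> * 1" using True by (intro mult_mono) auto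
          then show ?thesis using True by (simp add: abs_mult)
        qed simp
      qed
    qed (use \<tau> in \<open>auto simp: integrable_real_mult_indicator\<close>)
    fix t :: real
    consider "t < 0 \<or> t > \<tau>" | "0 \<le> t" "t \<le> 1 / B" | "1 / B < t" "t \<le> 64 / B" | "64 / B < t" "t \<le> \<tau>"
      by linarith
    then show "?k t \<le> indicator {0..\<tau>} t * ((\<tau> - t) * p t)"
    proof cases
      case 1
      then have "t \<notin> {0..\<tau>}" "t \<notin> {0..1 / B}" "t \<notin> {0..64 / B}" "t \<notin> {64 / B..\<tau>}"
        using R \<tau> B1 B_pos by (auto simp: not_le intro: less_le_trans)
      then show ?thesis by simp
    next
      case 2
      have "0 \<le> B * t" "B * t \<le> 1" using 2 B_pos by (auto simp: field_simps)
      then have "(B * t)\<^sup>2 \<le> 1\<^sup>2" by (intro power_mono)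
      then have "exp (- (B * t)\<^sup>2 / 2) \<ge> 1 / 2"
        using exp_ge_add_one_self[of "- (B * t)\<^sup>2 / 2"] by simp
      moreover have "p t \<ge> exp (- (B * t)\<^sup>2 / 2) - 1 / 1024"
        using 2 B1 by (intro p_near) auto
      ultimately have "p t \<ge> 1 / 2 - 1 / 1024" by linarith
      moreover have "\<tau> / 2 \<le> \<tau> - t" using 2 R B1 by linarith
      ultimately have "\<tau> / 2 * (1 / 2 - 1 / 1024) \<le> (\<tau> - t) * p t" using \<tau> by (intro mult_mono) auto
      moreover have "0 \<le> ?q t" using \<tau> by simp
      moreover have "t \<le> 64 / B" "t \<le> \<tau>" using 2 B1 R \<tau> by linarith+
      moreover have "?k t = \<tau> / 4 - \<tau> / 1024 - ?q t" using 2 \<open>t \<le> 64 / B\<close> by simp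
      moreover have "indicator {0..\<tau>} t * ((\<tau> - t) * p t) = (\<tau> - t) * p t" using 2 \<open>t \<le> \<tau>\<close> by simp
      ultimately show ?thesis using \<tau> by argo
    next
      case 3
      have "0 < 1 / B" using B_pos by simp
      then have t: "0 \<le> t" "t \<le> \<tau>" using 3 R \<tau> by linarith+
      have "p t \<ge> exp (- (B * t)\<^sup>2 / 2) - 1 / 1024"
        using 3 t by (intro p_near) auto
      moreover have "exp (- (B * t)\<^sup>2 / 2) \<ge> 0" by simp
      ultimately have "p t \<ge> - (1 / 1024)" by linarith
      then have "(\<tau> - t) * - (1 / 1024) \<le> (\<tau> - t) * p t" using t by (intro mult_left_mono) auto
      moreover have "0 \<le> ?q t" using \<tau> by simp
      moreover have "?k t = - (\<tau> / 1024) - ?q t" using 3 t by simp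
      moreover have "indicator {0..\<tau>} t * ((\<tau> - t) * p t) = (\<tau> - t) * p t" using t by simp
      ultimately show ?thesis using t by argo
    next
      case 4
      have "0 < 64 / B" using B_pos by simp
      then have t: "0 < t" using 4 by linarith
      have "t * (4 * C) \<le> \<tau> * L" using 4 t L C_pos by (intro mult_mono) auto
      then have "cmod (cf t) \<le> 1 / (1 + (B * t / 2)\<^sup>2)" using t L by (intro cmod_cf_le) (auto simp: \<tau>_def)
      also have "\<dots> \<le> 1 / (B * t / 2)\<^sup>2"
        using B_pos t by (intro divide_left_mono) (auto intro!: mult_pos_pos add_pos_pos)
      finally have "- (4 / (B * t)\<^sup>2) \<le> p t"
        using p_abs[of t] by (simp add: power_divide)
      then have "(\<tau> - t) * - (4 / (B * t)\<^sup>2) \<le> (\<tau> - t) * p t" using 4 by (intro mult_left_mono) auto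
      moreover have "\<tau> * - (4 / (B * t)\<^sup>2) \<le> (\<tau> - t) * - (4 / (B * t)\<^sup>2)"
        using t by (intro mult_right_mono_neg) auto
      ultimately have "- (4 * \<tau> / (B * t)\<^sup>2) \<le> (\<tau> - t) * p t" by simp
      then show ?thesis using 4 t B1 by simp
    qed
  qed
  finally have "2 / \<tau>\<^sup>2 * (\<tau> / (8 * B)) \<le> 2 / \<tau>\<^sup>2 * (\<integral>t. indicator {0..\<tau>} t * ((\<tau> - t) * p t) \<partial>lborel)"
    by (rule mult_left_mono) simp
  then show ?thesis
    using expectation_fejer[OF \<tau> measurable_S, of a, folded cf_def, unfolded p_eq] L by (simp add: \<tau>_def power2_eq_square)
qed

text \<open>The window is so wide that the part of the kernel outside it, which is controlled by
  \<open>expectation_inverse_square_le\<close> at the scale \<open>8192 * L\<close>, uses up only half of the lower bound of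
  \<open>expectation_fejer_ge\<close>.\<close>

lemma prob_near_ge:
  assumes L: "L > 0" "L \<ge> 4 * C" and B: "B \<ge> 2 ^ 51 * L" and a: "\<bar>a\<bar> \<le> 8192 * L"
  shows "prob {\<omega> \<in> space M. \<bar>S \<omega> - a\<bar> \<le> 8192 * L} \<ge> L / (8 * B)"
proof -
  define A where "A = {\<omega> \<in> space M. \<bar>S \<omega> - a\<bar> \<le> 8192 * L}"
  have [measurable]: "A \<in> events" unfolding A_def by measurable
  have int_A: "integrable M (indicator A :: 'a \<Rightarrow> real)"
    by (intro integrable_real_indicator) (auto simp: emeasure_eq_measure)
  \<comment> \<open>With \<open>R = 8192 * L\<close> and \<open>x > R\<close>, the kernel is at most
    \<open>4 * L\<^sup>2 / x\<^sup>2\<close>, while \<open>1 + x / R \<le> 2 * x / R\<close> bounds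
    \<open>?u\<close> below by \<open>R\<^sup>2 / (4 * x\<^sup>2)\<close>. The quotient of the two
    is \<open>16 * (L / R)\<^sup>2\<close>.\<close>
  let ?c = "16 / 8192\<^sup>2 :: real"
  let ?u = "\<lambda>\<omega>. 1 / (1 + \<bar>S \<omega> - a\<bar> / (8192 * L))\<^sup>2"
  have int_u: "integrable M ?u"
    using L by (intro integrable_const_bound[of _ 1]) (auto simp: divide_le_eq_1)
  have "L / (4 * B) \<le> expectation (\<lambda>\<omega>. fejer (1 / L) (S \<omega> - a))"
    by (rule expectation_fejer_ge[OF assms])
  also have "\<dots> \<le> expectation (\<lambda>\<omega>. indicator A \<omega> + ?c * ?u \<omega>)"
  proof (rule integral_mono)
    fix \<omega> assume \<omega>: "\<omega> \<in> space M"
    show "fejer (1 / L) (S \<omega> - a) \<le> indicator A \<omega> + ?c * ?u \<omega>"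
    proof (cases "\<omega> \<in> A")
      case True
      have "0 \<le> ?c * ?u \<omega>" by simp
      moreover have "fejer (1 / L) (S \<omega> - a) \<le> 1" using L by (simp add: fejer_le_1)
      ultimately show ?thesis using True unfolding indicator_simps(1)[OF True] by linarith
    next
      case False
      define x where "x = \<bar>S \<omega> - a\<bar>"
      have x: "x > 8192 * L" using False \<omega> by (simp add: A_def x_def)
      then have x0: "x > 0" using L by (meson less_trans mult_pos_pos zero_less_numeral)
      have "fejer (1 / L) (S \<omega> - a) \<le> 4 / (1 / L * (S \<omega> - a))\<^sup>2"
        using L x0 by (intro fejer_le) (auto simp: x_def)
      also have "\<dots> = ?c * (1 / (2 * x / (8192 * L))\<^sup>2)"
        using L x0 by (simp add: x_def field_simps power2_eq_square flip: abs_mult)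
      also have "\<dots> \<le> ?c * (1 / (1 + x / (8192 * L))\<^sup>2)"
      proof (intro mult_left_mono divide_left_mono power_mono)
        show "1 + x / (8192 * L) \<le> 2 * x / (8192 * L)" using x L by (simp add: field_simps)
      qed (use x0 L in \<open>auto intro!: mult_pos_pos add_pos_pos zero_less_power\<close>)
      finally show ?thesis using False by (simp add: x_def)
    qed
  next
    show "integrable M (\<lambda>\<omega>. indicator A \<omega> + ?c * ?u \<omega>)"
      by (intro Bochner_Integration.integrable_add integrable_mult_right int_u int_A)
  qed (use L in \<open>auto intro!: integrable_fejer\<close>)
  also have "\<dots> = prob A + ?c * expectation ?u"
    unfolding Bochner_Integration.integral_add[OF int_A integrable_mult_right[OF int_u]] integral_mult_right_zero by simp
  also have "?c * expectation ?u \<le> ?c * (16 * pi * (8192 * L) / B)"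
    using L C_pos by (intro mult_left_mono expectation_inverse_square_le) auto
  also have "\<dots> \<le> ?c * (16 * 4 * (8192 * L) / B)"
    using pi_less_4 L B_pos by (intro mult_left_mono divide_right_mono mult_mono) auto
  \<comment> \<open>This is where 8192 comes from: \<open>16 * 16 * 4 / 8192 = 1 / 8\<close>, half
    of the available 1/4.\<close>
  also have "\<dots> \<le> L / (8 * B)" using L B_pos by (simp add: field_simps)
  finally show ?thesis by (simp add: A_def field_simps)
qed

end

section \<open>Expectations of two-sided exponentials\<close>

text \<open>Both rates \<open>\<alpha>\<close> and \<open>1 - \<alpha>\<close> are at least their
  product. The integral of \<open>g_fun \<alpha>\<close> is
  \<open>1 / (\<alpha> * (1 - \<alpha>))\<close> and that of the symmetric bound is twice as large,
  so only a constant is lost.\<close>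

lemma g_fun_le:
  assumes "0 < \<alpha>" "\<alpha> < 1"
  shows "g_fun \<alpha> x \<le> exp (- (\<alpha> * (1 - \<alpha>) * \<bar>x\<bar>))"
proof (cases "x \<ge> 0")
  case True
  have "min (\<alpha> * x) ((\<alpha> - 1) * x) \<le> - (1 * ((1 - \<alpha>) * x))" by (simp add: algebra_simps)
  also have "\<dots> \<le> - (\<alpha> * ((1 - \<alpha>) * x))" using assms True by (intro le_imp_neg_le mult_right_mono) auto
  finally show ?thesis using True by (simp add: g_fun_def mult_ac)
next
  case False
  have "min (\<alpha> * x) ((\<alpha> - 1) * x) \<le> - (1 * (\<alpha> * - x))" by simp
  also have "\<dots> \<le> - ((1 - \<alpha>) * (\<alpha> * - x))" using assms False
    by (intro le_imp_neg_le mult_right_mono) (auto simp: mult_le_0_iff)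
  finally show ?thesis using False by (simp add: g_fun_def mult_ac)
qed

lemma exp_minus_le_inverse_square:
  fixes y z :: real
  assumes "0 \<le> z" "z \<le> y"
  shows "exp (- y) \<le> 4 * (1 / (1 + z)\<^sup>2)"
proof -
  have "1 + z \<le> 2 * exp (y / 2)" using exp_ge_add_one_self[of "y / 2"] assms by linarith
  then have "(1 + z)\<^sup>2 \<le> (2 * exp (y / 2))\<^sup>2" using assms by (intro power_mono) auto
  also have "\<dots> = 4 * exp y" by (simp add: power_mult_distrib flip: exp_of_nat_mult)
  finally have "exp (- y) * (1 + z)\<^sup>2 \<le> 4" by (simp add: exp_minus field_simps)
  moreover have "(1 + z)\<^sup>2 > 0" using assms by (intro zero_less_power) linarith
  ultimately show ?thesis by (simp add: pos_le_divide_eq)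
qed

context independent_sum
begin

text \<open>Since \<open>\<alpha> * (1 - \<alpha>) \<le> 1\<close>, the scale \<open>L\<close> is at
  least \<open>K\<close> and thus above \<open>4 * C\<close>, whatever the relation between
  \<open>\<alpha>\<close> and \<open>C\<close>. The inverse square at this scale dominates the
  exponential up to a factor 4.\<close>

lemma expectation_g_le:
  assumes \<alpha>: "0 < \<alpha>" "\<alpha> < 1" and K: "K \<ge> 1" "K \<ge> 4 * C"
  shows "expectation (\<lambda>\<omega>. g_fun \<alpha> (S \<omega>)) \<le> 64 * pi * K / (B * (1 - \<alpha>) * \<alpha>)"
proof -
  define L where "L = K / (\<alpha> * (1 - \<alpha>))"
  have pos: "0 < \<alpha> * (1 - \<alpha>)" and le1: "\<alpha> * (1 - \<alpha>) \<le> 1" using \<alpha> by (auto intro: mult_le_one)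
  have "K * 1 \<le> K / (\<alpha> * (1 - \<alpha>))" using pos le1 K by (simp add: pos_le_divide_eq mult_left_le)
  then have KL: "K \<le> L" by (simp add: L_def)
  then have L: "L > 0" "L \<ge> 4 * C" using K by auto
  have "expectation (\<lambda>\<omega>. g_fun \<alpha> (S \<omega>)) \<le> expectation (\<lambda>\<omega>. 4 * (1 / (1 + \<bar>S \<omega> - 0\<bar> / L)\<^sup>2))"
  proof (rule integral_mono')
    have "integrable M (\<lambda>\<omega>. 1 / (1 + \<bar>S \<omega> - 0\<bar> / L)\<^sup>2)"
      using L by (intro integrable_const_bound[of _ 1]) (auto simp: divide_le_eq_1)
    then show "integrable M (\<lambda>\<omega>. 4 * (1 / (1 + \<bar>S \<omega> - 0\<bar> / L)\<^sup>2))" by (rule integrable_mult_right)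
    fix \<omega>
    have "\<bar>S \<omega>\<bar> / L = \<alpha> * (1 - \<alpha>) * \<bar>S \<omega>\<bar> / K" using pos K by (simp add: L_def)
    also have "\<dots> \<le> \<alpha> * (1 - \<alpha>) * \<bar>S \<omega>\<bar>" using pos K mult_left_mono[of 1 K "\<alpha> * (1 - \<alpha>) * \<bar>S \<omega>\<bar>"]
      by (simp add: divide_le_eq)
    finally have "exp (- (\<alpha> * (1 - \<alpha>) * \<bar>S \<omega>\<bar>)) \<le> 4 * (1 / (1 + \<bar>S \<omega>\<bar> / L)\<^sup>2)"
      using L by (intro exp_minus_le_inverse_square) auto
    then show "g_fun \<alpha> (S \<omega>) \<le> 4 * (1 / (1 + \<bar>S \<omega> - 0\<bar> / L)\<^sup>2)"
      using g_fun_le[OF \<alpha>, of "S \<omega>"] by simp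
  qed simp
  also have "\<dots> = 4 * expectation (\<lambda>\<omega>. 1 / (1 + \<bar>S \<omega> - 0\<bar> / L)\<^sup>2)" by (rule integral_mult_right_zero)
  also have "\<dots> \<le> 4 * (16 * pi * L / B)" by (intro mult_left_mono expectation_inverse_square_le L) auto
  also have "\<dots> = 64 * pi * K / (B * (1 - \<alpha>) * \<alpha>)" by (simp add: L_def mult_ac)
  finally show ?thesis .
qed

lemma expectation_g_ge:
  assumes \<alpha>: "0 < \<alpha>" "\<alpha> < 1" and K: "K \<ge> 1" "K \<ge> 4 * C" and B: "2 ^ 51 * K \<le> B * (1 - \<alpha>) * \<alpha>"
  shows "exp (- (16384 * K)) * K / 16 / (B * (1 - \<alpha>) * \<alpha>) \<le> expectation (\<lambda>\<omega>. g_fun \<alpha> (S \<omega>))"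
proof -
  txt \<open>A window next to the origin, on the side where \<open>g_fun \<alpha>\<close> decays with the smaller rate \<open>\<beta> = min \<alpha> (1 - \<alpha>)\<close>.\<close>
  have "\<exists>\<beta> a. 0 < \<beta> \<and> \<beta> \<le> 1 \<and> B * (1 - \<alpha>) * \<alpha> \<le> B * \<beta> \<and> \<beta> \<le> 2 * ((1 - \<alpha>) * \<alpha>) \<and>
      \<bar>a\<bar> \<le> 8192 * (K / \<beta>) \<and> (\<forall>x. \<bar>x - a\<bar> \<le> 8192 * (K / \<beta>) \<longrightarrow> exp (- (16384 * K)) \<le> g_fun \<alpha> x)"
  proof (cases "\<alpha> \<le> 1 / 2")
    case True
    show ?thesis
    proof (intro exI conjI allI impI)
      show "B * (1 - \<alpha>) * \<alpha> \<le> B * \<alpha>" "\<alpha> \<le> 2 * ((1 - \<alpha>) * \<alpha>)" using \<alpha> True B_pos by auto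
      \<comment> \<open>The window is centred one radius away from the origin so that it ends there.
        Beyond the origin the rate is \<open>1 - \<alpha>\<close>, and over a length
        \<open>K / \<alpha>\<close> no lower bound in terms of \<open>K\<close> alone would
        hold.\<close>
      show "\<bar>- (8192 * (K / \<alpha>))\<bar> \<le> 8192 * (K / \<alpha>)" using \<alpha> K by simp
      fix x assume "\<bar>x - - (8192 * (K / \<alpha>))\<bar> \<le> 8192 * (K / \<alpha>)"
      then have x: "x \<le> 0" "- (16384 * (K / \<alpha>)) \<le> x" unfolding abs_le_iff by linarith+
      have "- (16384 * K) = \<alpha> * - (16384 * (K / \<alpha>))" using \<alpha> by simp
      also have "\<dots> \<le> \<alpha> * x" using \<alpha> x by (intro mult_left_mono) auto
      finally have 1: "- (16384 * K) \<le> \<alpha> * x" .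
      have "0 \<le> (\<alpha> - 1) * x" using \<alpha> x by (simp add: mult_nonpos_nonpos)
      then have "- (16384 * K) \<le> (\<alpha> - 1) * x" using K by linarith
      with 1 show "exp (- (16384 * K)) \<le> g_fun \<alpha> x" by (simp add: g_fun_def)
    qed (use \<alpha> in auto)
  next
    case False
    show ?thesis
    proof (intro exI conjI allI impI)
      show "B * (1 - \<alpha>) * \<alpha> \<le> B * (1 - \<alpha>)" using \<alpha> B_pos by (intro mult_left_le) auto
      show "1 - \<alpha> \<le> 2 * ((1 - \<alpha>) * \<alpha>)" using \<alpha> False mult_left_mono[of 1 "2 * \<alpha>" "1 - \<alpha>"] by simp
      show "\<bar>8192 * (K / (1 - \<alpha>))\<bar> \<le> 8192 * (K / (1 - \<alpha>))" using \<alpha> K by simp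
      fix x assume "\<bar>x - 8192 * (K / (1 - \<alpha>))\<bar> \<le> 8192 * (K / (1 - \<alpha>))"
      then have x: "0 \<le> x" "x \<le> 16384 * (K / (1 - \<alpha>))" unfolding abs_le_iff by linarith+
      have "(1 - \<alpha>) * x \<le> (1 - \<alpha>) * (16384 * (K / (1 - \<alpha>)))" using \<alpha> x by (intro mult_left_mono) auto
      also have "\<dots> = 16384 * K" using \<alpha> by simp
      finally have 1: "- (16384 * K) \<le> (\<alpha> - 1) * x" by (simp add: algebra_simps)
      have "0 \<le> \<alpha> * x" using \<alpha> x by simp
      then have "- (16384 * K) \<le> \<alpha> * x" using K by linarith
      with 1 show "exp (- (16384 * K)) \<le> g_fun \<alpha> x" by (simp add: g_fun_def)
    qed (use \<alpha> in auto)
  qed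
  then obtain \<beta> a where \<beta>: "0 < \<beta>" "\<beta> \<le> 1" "B * (1 - \<alpha>) * \<alpha> \<le> B * \<beta>" "\<beta> \<le> 2 * ((1 - \<alpha>) * \<alpha>)"
    and a: "\<bar>a\<bar> \<le> 8192 * (K / \<beta>)"
    and g: "\<And>x. \<bar>x - a\<bar> \<le> 8192 * (K / \<beta>) \<Longrightarrow> exp (- (16384 * K)) \<le> g_fun \<alpha> x" by blast
  define L where "L = K / \<beta>"
  have "K \<le> L" using \<beta> K by (simp add: L_def pos_le_divide_eq mult_left_le)
  then have L: "L > 0" "L \<ge> 4 * C" using K by auto
  have BL: "B \<ge> 2 ^ 51 * L" using B \<beta> by (simp add: L_def pos_divide_le_eq)
  define A where "A = {\<omega> \<in> space M. \<bar>S \<omega> - a\<bar> \<le> 8192 * L}"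
  have [measurable]: "A \<in> events" unfolding A_def by measurable
  have "g_fun \<alpha> x \<le> 1" for x
    by (rule order.trans[OF g_fun_le[OF \<alpha>]]) (use \<alpha> in simp)
  then have int_g: "integrable M (\<lambda>\<omega>. g_fun \<alpha> (S \<omega>))"
    by (intro integrable_const_bound[of _ 1]) (auto simp: g_fun_def[abs_def])
  \<comment> \<open>Replacing the width \<open>1 / \<beta>\<close> by
    \<open>1 / (\<alpha> * (1 - \<alpha>))\<close> costs a factor 2. With the 8 from
    \<open>prob_near_ge\<close> this gives the 16 in the constant.\<close>
  have "B * (K * \<beta>) \<le> B * (K * (2 * ((1 - \<alpha>) * \<alpha>)))"
    using \<beta>(4) K B_pos by (intro mult_left_mono) auto
  then have "K / (B * (1 - \<alpha>) * \<alpha>) \<le> 2 * L / B"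
    using \<alpha> \<beta> K B_pos by (simp add: L_def field_simps)
  then have "exp (- (16384 * K)) / 16 * (K / (B * (1 - \<alpha>) * \<alpha>)) \<le> exp (- (16384 * K)) / 16 * (2 * L / B)"
    by (rule mult_left_mono) simp
  then have "exp (- (16384 * K)) * K / 16 / (B * (1 - \<alpha>) * \<alpha>) \<le> exp (- (16384 * K)) * (L / (8 * B))"
    by (simp add: mult.commute[of L])
  also have "\<dots> \<le> exp (- (16384 * K)) * prob A"
    unfolding A_def using a by (intro mult_left_mono prob_near_ge L BL) (auto simp: L_def)
  also have "\<dots> = expectation (\<lambda>\<omega>. indicator A \<omega> * exp (- (16384 * K)))" by (simp add: mult.commute)
  also have "\<dots> \<le> expectation (\<lambda>\<omega>. g_fun \<alpha> (S \<omega>))"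
  proof (rule integral_mono[OF _ int_g])
    show "integrable M (\<lambda>\<omega>. indicator A \<omega> * exp (- (16384 * K)))"
      by (intro integrable_mult_left integrable_real_indicator) (auto simp: emeasure_eq_measure)
    show "indicator A \<omega> * exp (- (16384 * K)) \<le> g_fun \<alpha> (S \<omega>)" for \<omega>
      using g[of "S \<omega>"] by (auto simp: A_def L_def indicator_def g_fun_def)
  qed
  finally show ?thesis .
qed

end

section \<open>Chernoff divergence\<close>

lemma power_le_exp:
  fixes x :: real
  assumes "x \<ge> 0" "m > 0" "k > 0"
  shows "x ^ k \<le> (real k / m) ^ k * exp (m * x)"
proof -
  have "m * x / real k \<le> exp (m * x / real k)" using exp_ge_add_one_self[of "m * x / real k"] by linarith
  then have "(m * x / real k) ^ k \<le> exp (m * x / real k) ^ k"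
    using assms by (intro power_mono) auto
  also have "\<dots> = exp (m * x)" using assms by (simp flip: exp_of_nat_mult)
  finally have "(real k / m) ^ k * (m * x / real k) ^ k \<le> (real k / m) ^ k * exp (m * x)"
    using assms by (intro mult_left_mono) auto
  then show ?thesis using assms by (simp add: power_divide power_mult_distrib)
qed

lemma exp_le_quadratic:
  fixes y :: real
  shows "exp y \<le> 1 + y + y\<^sup>2 * exp \<bar>y\<bar>"
proof -
  obtain t where t: "\<bar>t\<bar> \<le> \<bar>y\<bar>" "exp y = (\<Sum>m<2. y ^ m / fact m) + exp t / fact 2 * y ^ 2"
    using Maclaurin_exp_le[of y 2] by blast
  have "exp t / 2 * y\<^sup>2 \<le> exp \<bar>y\<bar> * y\<^sup>2"
  proof (intro mult_right_mono)
    have "exp t \<le> exp \<bar>y\<bar>" "0 < exp t" using t(1) by auto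
    then show "exp t / 2 \<le> exp \<bar>y\<bar>" by linarith
  qed simp
  then show ?thesis using t(2) by (simp add: numeral_2_eq_2 mult.commute)
qed

context prob_space
begin

lemma integrable_abs_power:
  fixes X :: "'a \<Rightarrow> real"
  assumes [measurable]: "random_variable borel X" and "m > 0" "k > 0"
    and int: "integrable M (\<lambda>\<omega>. exp (m * \<bar>X \<omega>\<bar>))"
  shows "integrable M (\<lambda>\<omega>. \<bar>X \<omega>\<bar> ^ k)"
proof (rule Bochner_Integration.integrable_bound)
  show "integrable M (\<lambda>\<omega>. (real k / m) ^ k * exp (m * \<bar>X \<omega>\<bar>))" using int by simp
  show "AE \<omega> in M. norm (\<bar>X \<omega>\<bar> ^ k) \<le> norm ((real k / m) ^ k * exp (m * \<bar>X \<omega>\<bar>))"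
    using power_le_exp[OF abs_ge_zero assms(2,3)] assms by (auto simp: abs_mult)
qed measurable

text \<open>The first-order condition for a minimum at 0. Instead of differentiating under the
  integral, the quadratic bound is divided by \<open>h\<close> of either sign and \<open>h\<close>
  tends to 0 from each side.\<close>

lemma expectation_eq_0_if_mgf_ge_1:
  fixes X :: "'a \<Rightarrow> real"
  assumes [measurable]: "random_variable borel X" and m: "m > 0"
    and int: "integrable M (\<lambda>\<omega>. exp (m * \<bar>X \<omega>\<bar>))"
    and ge: "\<And>h. \<bar>h\<bar> < m \<Longrightarrow> expectation (\<lambda>\<omega>. exp (h * X \<omega>)) \<ge> 1"
  shows "expectation X = 0"
proof -
  have int_X: "integrable M X"
    using integrable_abs_power[OF assms(1) m _ int, of 1] by (simp add: integrable_abs_iff)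
  \<comment> \<open>The exponential moment of order \<open>m\<close> is split in halves: one
    controls \<open>exp \<bar>h * X\<bar>\<close>, the other the factor \<open>X\<^sup>2\<close>
    through \<open>power_le_exp\<close> with rate \<open>m / 2\<close>.\<close>
  define K where "K = (2 / (m / 2))\<^sup>2 * expectation (\<lambda>\<omega>. exp (m * \<bar>X \<omega>\<bar>))"
  txt \<open>The moment generating function is \<open>1 + h E X + O(h\<^sup>2)\<close> near 0.\<close>
  have K: "0 \<le> h * expectation X + h\<^sup>2 * K" if h: "\<bar>h\<bar> \<le> m / 2" for h
  proof -
    have "1 \<le> expectation (\<lambda>\<omega>. exp (h * X \<omega>))" using h m by (intro ge) linarith
    also have "\<dots> \<le> expectation (\<lambda>\<omega>. 1 + h * X \<omega> + h\<^sup>2 * ((2 / (m / 2))\<^sup>2 * exp (m * \<bar>X \<omega>\<bar>)))"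
    proof (rule integral_mono)
      show "integrable M (\<lambda>\<omega>. exp (h * X \<omega>))"
      proof (rule Bochner_Integration.integrable_bound[OF int])
        have "h * X \<omega> \<le> m * \<bar>X \<omega>\<bar>" for \<omega>
        proof -
          have "h * X \<omega> \<le> \<bar>h\<bar> * \<bar>X \<omega>\<bar>" by (simp flip: abs_mult)
          also have "\<dots> \<le> m * \<bar>X \<omega>\<bar>" using h m by (intro mult_right_mono) auto
          finally show ?thesis .
        qed
        then show "AE \<omega> in M. norm (exp (h * X \<omega>)) \<le> norm (exp (m * \<bar>X \<omega>\<bar>))" by simp
      qed measurable
      show "integrable M (\<lambda>\<omega>. 1 + h * X \<omega> + h\<^sup>2 * ((2 / (m / 2))\<^sup>2 * exp (m * \<bar>X \<omega>\<bar>)))"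
        using int int_X by (intro Bochner_Integration.integrable_add integrable_mult_right) auto
      fix \<omega>
      have "\<bar>X \<omega>\<bar> ^ 2 * exp \<bar>h * X \<omega>\<bar> \<le> (real 2 / (m / 2))\<^sup>2 * exp (m / 2 * \<bar>X \<omega>\<bar>) * exp (m / 2 * \<bar>X \<omega>\<bar>)"
        using h m mult_right_mono[OF h abs_ge_zero[of "X \<omega>"]]
        by (intro mult_mono power_le_exp) (auto simp: abs_mult)
      also have "\<dots> = (2 / (m / 2))\<^sup>2 * exp (m * \<bar>X \<omega>\<bar>)"
        by (simp flip: exp_add)
      finally have "h\<^sup>2 * (\<bar>X \<omega>\<bar> ^ 2 * exp \<bar>h * X \<omega>\<bar>) \<le> h\<^sup>2 * ((2 / (m / 2))\<^sup>2 * exp (m * \<bar>X \<omega>\<bar>))"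
        by (intro mult_left_mono) auto
      then show "exp (h * X \<omega>) \<le> 1 + h * X \<omega> + h\<^sup>2 * ((2 / (m / 2))\<^sup>2 * exp (m * \<bar>X \<omega>\<bar>))"
        using exp_le_quadratic[of "h * X \<omega>"] by (simp add: power_mult_distrib mult.assoc)
    qed
    also have "\<dots> = 1 + h * expectation X + h\<^sup>2 * K"
      using int int_X by (simp add: K_def prob_space)
    finally show ?thesis by simp
  qed
  have lim: "((\<lambda>h. expectation X + h * K) \<longlongrightarrow> expectation X + 0 * K) (at 0 within U)" for U
    by (intro tendsto_intros)
  have "\<forall>\<^sub>F h in at_right 0. 0 \<le> expectation X + h * K"
    using eventually_at_right_real[OF half_gt_zero[OF m]]
  proof eventually_elim
    case (elim h)
    then have "0 \<le> h * (expectation X + h * K)" using K[of h] by (auto simp: power2_eq_square algebra_simps)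
    then show ?case using elim by (simp add: zero_le_mult_iff)
  qed
  then have "expectation X \<ge> 0" using tendsto_lowerbound[OF lim] by simp
  have "\<forall>\<^sub>F h in at_left 0. expectation X + h * K \<le> 0"
    using eventually_at_left_real[of "- (m / 2)" 0, simplified, OF m]
  proof eventually_elim
    case (elim h)
    then have "0 \<le> h * (expectation X + h * K)" using K[of h] by (auto simp: power2_eq_square algebra_simps)
    then show ?case using elim by (simp add: zero_le_mult_iff)
  qed
  then have "expectation X \<le> 0" using tendsto_upperbound[OF lim] by simp
  with \<open>expectation X \<ge> 0\<close> show ?thesis by simp
qed

end

section \<open>Affinities and tilting of a pair of densities\<close>

lemma is_prob_density_integral:
  assumes "is_prob_density M p"
  shows "integrable M p" "(\<integral>x. p x \<partial>M) = 1"
proof -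
  have [measurable]: "p \<in> borel_measurable M" and nn: "\<And>x. x \<in> space M \<Longrightarrow> 0 \<le> p x"
    and "prob_space (density M p)"
    using assms by (auto simp: is_prob_density_def)
  then have "(\<integral>\<^sup>+x. ennreal (p x) \<partial>M) = ennreal 1"
    using prob_space.emeasure_space_1[of "density M p"] by (simp add: emeasure_density cong: nn_integral_cong)
  then have "has_bochner_integral M p 1"
    using nn by (intro has_bochner_integral_nn_integral) auto
  then show "integrable M p" "(\<integral>x. p x \<partial>M) = 1"
    by (auto simp: has_bochner_integral_iff)
qed

text \<open>The tilted density before normalization. As \<open>0 powr 0 = 0\<close>, at exponents 0
  and 1 this is \<open>p\<close> or \<open>q\<close> restricted to the set where both are nonzero,
  which makes it continuous in \<alpha> up to the endpoints.\<close>

definition geometric_mean :: "('a \<Rightarrow> real) \<Rightarrow> ('a \<Rightarrow> real) \<Rightarrow> real \<Rightarrow> 'a \<Rightarrow> real" where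
  "geometric_mean p q \<alpha> x = p x powr (1 - \<alpha>) * q x powr \<alpha>"

lemma geometric_mean_nonneg: "geometric_mean p q \<alpha> x \<ge> 0"
  by (simp add: geometric_mean_def)

lemma geometric_mean_eq_0_iff: "geometric_mean p q \<alpha> x = 0 \<longleftrightarrow> p x = 0 \<or> q x = 0"
  by (simp add: geometric_mean_def)

lemma geometric_mean_le:
  assumes "p x \<ge> 0" "q x \<ge> 0" "0 \<le> \<alpha>" "\<alpha> \<le> 1"
  shows "geometric_mean p q \<alpha> x \<le> p x + q x"
proof -
  let ?m = "max (p x) (q x)"
  have "geometric_mean p q \<alpha> x \<le> ?m powr (1 - \<alpha>) * ?m powr \<alpha>"
    unfolding geometric_mean_def using assms by (intro mult_mono powr_mono2) auto
  also have "\<dots> = ?m powr 1" by (simp flip: powr_add)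
  also have "\<dots> \<le> p x + q x" using assms by (simp add: max_def)
  finally show ?thesis .
qed

text \<open>Multiplying by the power \<open>h\<close> of the likelihood ratio moves the exponent by
  \<open>h\<close>; where a density vanishes, both sides are 0.\<close>

lemma geometric_mean_shift:
  assumes "p x \<ge> 0" "q x \<ge> 0"
  shows "geometric_mean p q \<alpha> x * exp (h * ln (p x / q x)) = geometric_mean p q (\<alpha> - h) x"
proof (cases "p x = 0 \<or> q x = 0")
  case False
  then show ?thesis using assms
    by (simp add: geometric_mean_def powr_def ln_div algebra_simps flip: exp_add)
qed (auto simp: geometric_mean_def)

locale density_pair = sigma_finite_measure M for M :: "'a measure" +
  fixes p q :: "'a \<Rightarrow> real"
  assumes density_p: "is_prob_density M p" and density_q: "is_prob_density M q"
begin

lemma measurable_pq [measurable]: "p \<in> borel_measurable M" "q \<in> borel_measurable M"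
  using density_p density_q by (auto simp: is_prob_density_def)

lemma pq_nonneg: "x \<in> space M \<Longrightarrow> p x \<ge> 0" "x \<in> space M \<Longrightarrow> q x \<ge> 0"
  using density_p density_q by (auto simp: is_prob_density_def)

definition affinity :: "real \<Rightarrow> real" where
  "affinity \<alpha> = (\<integral>x. geometric_mean p q \<alpha> x \<partial>M)"

lemma measurable_geometric_mean [measurable]: "geometric_mean p q \<alpha> \<in> borel_measurable M"
  unfolding geometric_mean_def[abs_def] by measurable

lemma integrable_geometric_mean:
  assumes "0 \<le> \<alpha>" "\<alpha> \<le> 1"
  shows "integrable M (geometric_mean p q \<alpha>)"
proof (rule Bochner_Integration.integrable_bound)
  show "integrable M (\<lambda>x. p x + q x)" using is_prob_density_integral density_p density_q by auto
  show "AE x in M. norm (geometric_mean p q \<alpha> x) \<le> norm (p x + q x)"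
    using geometric_mean_le[of p _ q, OF _ _ assms] pq_nonneg by (auto simp: geometric_mean_nonneg)
qed measurable

lemma chernoff_div_eq: "chernoff_div M p q \<alpha> = - ln (affinity \<alpha>)"
  by (simp add: chernoff_div_def affinity_def geometric_mean_def)

lemma tilted_density_eq:
  assumes "affinity \<alpha> > 0"
  shows "tilted_density M p q \<alpha> x = geometric_mean p q \<alpha> x / affinity \<alpha>"
  using assms by (simp add: tilted_density_def chernoff_div_eq geometric_mean_def exp_minus inverse_eq_divide)

lemma measurable_tilted_density [measurable]: "tilted_density M p q \<alpha> \<in> borel_measurable M"
  unfolding tilted_density_def[abs_def] by measurable

lemma prob_space_tilted:
  assumes "0 \<le> \<alpha>" "\<alpha> \<le> 1" "affinity \<alpha> > 0"
  shows "prob_space (density M (tilted_density M p q \<alpha>))"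
proof (rule prob_spaceI)
  have "(\<integral>\<^sup>+x. ennreal (tilted_density M p q \<alpha> x) \<partial>M) = ennreal (\<integral>x. tilted_density M p q \<alpha> x \<partial>M)"
    using assms integrable_geometric_mean
    by (intro nn_integral_eq_integral) (auto simp: tilted_density_eq geometric_mean_nonneg)
  also have "(\<integral>x. tilted_density M p q \<alpha> x \<partial>M) = 1"
    using assms by (simp add: tilted_density_eq affinity_def)
  finally show "emeasure (density M (tilted_density M p q \<alpha>)) (space (density M (tilted_density M p q \<alpha>))) = 1"
    by (simp add: emeasure_density cong: nn_integral_cong)
qed

lemma AE_tilted_pos:
  "AE x in density M (tilted_density M p q \<alpha>). p x > 0 \<and> q x > 0"
proof -
  have "p x > 0 \<and> q x > 0" if "x \<in> space M" "tilted_density M p q \<alpha> x > 0" for x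
    using that pq_nonneg[OF that(1)] by (cases "p x = 0"; cases "q x = 0") (auto simp: tilted_density_def)
  then show ?thesis by (subst AE_density) auto
qed

text \<open>The moment generating function of the log-likelihood ratio is a quotient of affinities.
  Hence minimality of the affinity at \<alpha> says that this function is at least 1 near 0.\<close>

lemma tilted_mgf:
  assumes "affinity \<alpha> > 0" "0 \<le> \<alpha> - h" "\<alpha> - h \<le> 1"
  shows "integrable (density M (tilted_density M p q \<alpha>)) (\<lambda>x. exp (h * ln (p x / q x)))"
    and "(\<integral>x. exp (h * ln (p x / q x)) \<partial>density M (tilted_density M p q \<alpha>)) = affinity (\<alpha> - h) / affinity \<alpha>"
proof -
  have eq: "tilted_density M p q \<alpha> x * exp (h * ln (p x / q x)) = geometric_mean p q (\<alpha> - h) x / affinity \<alpha>"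
    if "x \<in> space M" for x
    using geometric_mean_shift[of p x q \<alpha> h] pq_nonneg[OF that] assms by (simp add: tilted_density_eq)
  have nn: "AE x in M. 0 \<le> tilted_density M p q \<alpha> x" by (simp add: tilted_density_def)
  have "integrable M (\<lambda>x. geometric_mean p q (\<alpha> - h) x / affinity \<alpha>)"
    using integrable_geometric_mean assms by simp
  then show "integrable (density M (tilted_density M p q \<alpha>)) (\<lambda>x. exp (h * ln (p x / q x)))"
    using nn eq by (subst integrable_density) (auto cong: Bochner_Integration.integrable_cong)
  show "(\<integral>x. exp (h * ln (p x / q x)) \<partial>density M (tilted_density M p q \<alpha>)) = affinity (\<alpha> - h) / affinity \<alpha>"
    using nn by (subst integral_density) (auto simp: eq affinity_def cong: Bochner_Integration.integral_cong)
qed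

lemma integrable_tilted_exp_abs:
  assumes \<alpha>: "affinity \<alpha> > 0" and m: "m \<le> \<alpha>" "m \<le> 1 - \<alpha>" "0 < m"
  shows "integrable (density M (tilted_density M p q \<alpha>)) (\<lambda>x. exp (m * \<bar>ln (p x / q x)\<bar>))"
proof (rule Bochner_Integration.integrable_bound)
  let ?N = "density M (tilted_density M p q \<alpha>)"
  show "integrable ?N (\<lambda>x. exp (m * ln (p x / q x)) + exp (- m * ln (p x / q x)))"
    using m by (intro Bochner_Integration.integrable_add tilted_mgf \<alpha>) auto
  show "AE x in ?N. norm (exp (m * \<bar>ln (p x / q x)\<bar>)) \<le> norm (exp (m * ln (p x / q x)) + exp (- m * ln (p x / q x)))"
  proof (rule AE_I2)
    fix x
    have "norm (exp (m * \<bar>y\<bar>)) \<le> norm (exp (m * y) + exp (- m * y))" for y :: real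
    proof -
      have "exp (m * \<bar>y\<bar>) \<le> exp (m * y) + exp (- m * y)" by (cases "y \<ge> 0") auto
      then show ?thesis by simp
    qed
    then show "norm (exp (m * \<bar>ln (p x / q x)\<bar>)) \<le> norm (exp (m * ln (p x / q x)) + exp (- m * ln (p x / q x)))" .
  qed
qed simp

lemma affinity_pos:
  assumes supp: "AE x in M. p x = 0 \<longleftrightarrow> q x = 0" and \<alpha>: "0 \<le> \<alpha>" "\<alpha> \<le> 1"
  shows "affinity \<alpha> > 0"
proof (rule ccontr)
  assume "\<not> affinity \<alpha> > 0"
  moreover have "affinity \<alpha> \<ge> 0" unfolding affinity_def by (simp add: geometric_mean_nonneg)
  ultimately have "(\<integral>x. geometric_mean p q \<alpha> x \<partial>M) = 0" by (simp add: affinity_def)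
  then have "AE x in M. geometric_mean p q \<alpha> x = 0"
    using integrable_geometric_mean[OF \<alpha>] by (subst (asm) integral_nonneg_eq_0_iff_AE) (auto simp: geometric_mean_nonneg)
  with supp have "AE x in M. p x = 0" by eventually_elim (auto simp: geometric_mean_eq_0_iff)
  then have "(\<integral>x. p x \<partial>M) = (\<integral>x. 0 \<partial>M)" by (intro integral_cong_AE) auto
  then show False using is_prob_density_integral(2)[OF density_p] by simp
qed

lemma affinity_endpoints:
  assumes supp: "AE x in M. p x = 0 \<longleftrightarrow> q x = 0"
  shows "affinity 0 = 1" "affinity 1 = 1"
proof -
  have "affinity 0 = (\<integral>x. p x \<partial>M)"
    unfolding affinity_def using supp AE_space[of M]
    by (intro integral_cong_AE) (auto elim!: eventually_elim2 simp: geometric_mean_def pq_nonneg powr_one')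
  then show "affinity 0 = 1" using is_prob_density_integral[OF density_p] by simp
  have "affinity 1 = (\<integral>x. q x \<partial>M)"
    unfolding affinity_def using supp AE_space[of M]
    by (intro integral_cong_AE) (auto elim!: eventually_elim2 simp: geometric_mean_def pq_nonneg powr_one')
  then show "affinity 1 = 1" using is_prob_density_integral[OF density_q] by simp
qed

text \<open>The squared Hellinger distance equals \<open>2 - 2 * affinity (1 / 2)\<close> and
  vanishes only for densities that agree almost everywhere.\<close>

lemma affinity_half_less:
  assumes "\<not> (AE x in M. p x = q x)"
  shows "affinity (1 / 2) < 1"
proof -
  let ?d = "\<lambda>x. (sqrt (p x) - sqrt (q x))\<^sup>2"
  have d: "?d x = p x + q x - 2 * geometric_mean p q (1 / 2) x" if "x \<in> space M" for x
    using pq_nonneg[OF that]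
    by (simp add: geometric_mean_def powr_half_sqrt power2_diff)
  have int: "integrable M (\<lambda>x. p x + q x - 2 * geometric_mean p q (1 / 2) x)"
    by (intro Bochner_Integration.integrable_diff Bochner_Integration.integrable_add integrable_mult_right
        is_prob_density_integral(1) density_p density_q integrable_geometric_mean) auto
  then have int_d: "integrable M ?d" by (subst Bochner_Integration.integrable_cong[OF refl d])
  have "(\<integral>x. ?d x \<partial>M) \<noteq> 0"
  proof
    assume "(\<integral>x. ?d x \<partial>M) = 0"
    then have "AE x in M. ?d x = 0" using int_d by (subst (asm) integral_nonneg_eq_0_iff_AE) auto
    then have "AE x in M. p x = q x" by eventually_elim simp
    with assms show False by simp
  qed
  moreover have "(\<integral>x. ?d x \<partial>M) \<ge> 0" by simp
  moreover have "(\<integral>x. ?d x \<partial>M) = 2 - 2 * affinity (1 / 2)"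
    using is_prob_density_integral[OF density_p] is_prob_density_integral[OF density_q] integrable_geometric_mean[of "1 / 2"]
    by (subst Bochner_Integration.integral_cong[OF refl d]) (auto simp: affinity_def)
  ultimately show ?thesis by linarith
qed

lemma continuous_on_affinity: "continuous_on {0..1} affinity"
proof (rule continuous_on_sequentiallyI)
  fix u :: "nat \<Rightarrow> real" and a assume u: "\<forall>n. u n \<in> {0..1}" "a \<in> {0..1}" "u \<longlonglongrightarrow> a"
  show "(\<lambda>n. affinity (u n)) \<longlonglongrightarrow> affinity a"
    unfolding affinity_def
  proof (rule integral_dominated_convergence[where w = "\<lambda>x. p x + q x"])
    show "integrable M (\<lambda>x. p x + q x)" using is_prob_density_integral density_p density_q by auto
    show "AE x in M. (\<lambda>n. geometric_mean p q (u n) x) \<longlonglongrightarrow> geometric_mean p q a x"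
    proof (rule AE_I2)
      fix x
      show "(\<lambda>n. geometric_mean p q (u n) x) \<longlonglongrightarrow> geometric_mean p q a x"
      proof (cases "p x = 0 \<or> q x = 0")
        case False
        then show ?thesis unfolding geometric_mean_def by (intro tendsto_intros u) auto
      qed (auto simp: geometric_mean_def)
    qed
    show "AE x in M. norm (geometric_mean p q (u n) x) \<le> p x + q x" for n
      using u(1) pq_nonneg by (auto simp: geometric_mean_nonneg intro!: geometric_mean_le)
  qed auto
qed

text \<open>The affinity attains its minimum on the compact interval; it is 1 at both ends and
  smaller at 1/2, so the minimum is interior. Existence is what makes the value chosen by
  \<open>arg_max\<close> a genuine maximizer.\<close>

lemma chernoff_argmax_minimizes:
  assumes supp: "AE x in M. p x = 0 \<longleftrightarrow> q x = 0" and neq: "\<not> (AE x in M. p x = q x)"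
  defines "\<alpha> \<equiv> chernoff_argmax M p q"
  shows "0 < \<alpha>" "\<alpha> < 1" and "\<And>\<beta>. 0 < \<beta> \<Longrightarrow> \<beta> < 1 \<Longrightarrow> affinity \<alpha> \<le> affinity \<beta>"
proof -
  obtain a where a: "a \<in> {0..1}" "\<And>b. b \<in> {0..1} \<Longrightarrow> affinity a \<le> affinity b"
    using continuous_attains_inf[OF _ _ continuous_on_affinity] by auto
  have "affinity a < 1" using a(2)[of "1 / 2"] affinity_half_less[OF neq] by simp
  then have a01: "0 < a" "a < 1" using a(1) affinity_endpoints[OF supp] by (auto simp: less_le)
  have mono: "chernoff_div M p q c \<le> chernoff_div M p q b \<longleftrightarrow> affinity b \<le> affinity c"
    if "0 < b" "b < 1" "0 < c" "c < 1" for b c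
    using that affinity_pos[OF supp, of b] affinity_pos[OF supp, of c] by (simp add: chernoff_div_eq)
  have "is_arg_max (chernoff_div M p q) (\<lambda>\<alpha>. \<alpha> \<in> {0<..<1}) a"
    using a a01 mono by (auto simp: is_arg_max_linorder)
  then have "is_arg_max (chernoff_div M p q) (\<lambda>\<alpha>. \<alpha> \<in> {0<..<1}) \<alpha>"
    unfolding \<alpha>_def chernoff_argmax_def arg_max_def by (rule someI)
  then have 1: "0 < \<alpha>" "\<alpha> < 1"
    and 2: "\<And>\<beta>. 0 < \<beta> \<Longrightarrow> \<beta> < 1 \<Longrightarrow> chernoff_div M p q \<beta> \<le> chernoff_div M p q \<alpha>"
    by (auto simp: is_arg_max_linorder)
  show "0 < \<alpha>" "\<alpha> < 1" by (fact 1)+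
  show "affinity \<alpha> \<le> affinity \<beta>" if "0 < \<beta>" "\<beta> < 1" for \<beta>
    using 2[OF that] mono that 1 by simp
qed

lemma expectation_llr_tilted_eq_0:
  assumes supp: "AE x in M. p x = 0 \<longleftrightarrow> q x = 0" and neq: "\<not> (AE x in M. p x = q x)"
  defines "\<alpha> \<equiv> chernoff_argmax M p q"
  shows "(\<integral>x. ln (p x / q x) \<partial>density M (tilted_density M p q \<alpha>)) = 0"
proof -
  note * = chernoff_argmax_minimizes[OF supp neq, folded \<alpha>_def]
  have pos: "affinity \<alpha> > 0" using * by (intro affinity_pos supp) auto
  interpret N: prob_space "density M (tilted_density M p q \<alpha>)"
    using * pos by (intro prob_space_tilted) auto
  define m where "m = min \<alpha> (1 - \<alpha>)"
  show ?thesis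
  proof (rule N.expectation_eq_0_if_mgf_ge_1)
    show "0 < m" using * by (simp add: m_def)
    show "integrable (density M (tilted_density M p q \<alpha>)) (\<lambda>x. exp (m * \<bar>ln (p x / q x)\<bar>))"
      using * pos by (intro integrable_tilted_exp_abs) (auto simp: m_def)
    fix h :: real assume "\<bar>h\<bar> < m"
    then have "0 < \<alpha> - h" "\<alpha> - h < 1" by (auto simp: m_def)
    then show "1 \<le> (\<integral>x. exp (h * ln (p x / q x)) \<partial>density M (tilted_density M p q \<alpha>))"
      using * pos by (subst tilted_mgf) auto
  qed simp
qed

text \<open>The two branches of \<open>g_fun\<close> shift the geometric mean to exponents 0 and 1,
  that is, to \<open>p\<close> and \<open>q\<close>.\<close>

lemma min_eq_tilted_g:
  assumes x: "x \<in> space M" and "affinity \<alpha> > 0"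
  shows "min (p x) (q x) = exp (- chernoff_div M p q \<alpha>) * (tilted_density M p q \<alpha> x * g_fun \<alpha> (ln (p x / q x)))"
proof (cases "p x = 0 \<or> q x = 0")
  case True
  then show ?thesis using pq_nonneg[OF x] by (auto simp: tilted_density_def)
next
  case False
  then have pos: "p x > 0" "q x > 0" using pq_nonneg[OF x] by auto
  have "g_fun \<alpha> (ln (p x / q x)) = min (exp (\<alpha> * ln (p x / q x))) (exp ((\<alpha> - 1) * ln (p x / q x)))"
    by (simp add: g_fun_def min_def)
  moreover have "exp (- chernoff_div M p q \<alpha>) * (tilted_density M p q \<alpha> x * g_fun \<alpha> (ln (p x / q x)))
      = geometric_mean p q \<alpha> x * g_fun \<alpha> (ln (p x / q x))"
    using assms by (simp add: tilted_density_eq chernoff_div_eq)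
  moreover have "geometric_mean p q \<alpha> x * min (exp (\<alpha> * ln (p x / q x))) (exp ((\<alpha> - 1) * ln (p x / q x)))
      = min (geometric_mean p q 0 x) (geometric_mean p q 1 x)"
    using geometric_mean_shift[of p x q \<alpha> \<alpha>] geometric_mean_shift[of p x q \<alpha> "\<alpha> - 1"] pos
    by (simp add: min_mult_distrib_left geometric_mean_nonneg)
  moreover have "min (geometric_mean p q 0 x) (geometric_mean p q 1 x) = min (p x) (q x)"
    using pos by (simp add: geometric_mean_def)
  ultimately show ?thesis by simp
qed

lemma measurable_g_fun [measurable]: "g_fun \<alpha> \<in> borel_measurable borel"
  unfolding g_fun_def[abs_def] by measurable

lemma tv_affinity_eq:
  assumes "affinity \<alpha> > 0"
  shows "tv_affinity M p q = exp (- chernoff_div M p q \<alpha>) *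
    (\<integral>x. g_fun \<alpha> (ln (p x / q x)) \<partial>density M (tilted_density M p q \<alpha>))"
proof -
  have "tv_affinity M p q =
      (\<integral>x. exp (- chernoff_div M p q \<alpha>) * (tilted_density M p q \<alpha> x * g_fun \<alpha> (ln (p x / q x))) \<partial>M)"
    unfolding tv_affinity_def using assms by (intro Bochner_Integration.integral_cong min_eq_tilted_g) auto
  also have "\<dots> = exp (- chernoff_div M p q \<alpha>) *
      (\<integral>x. g_fun \<alpha> (ln (p x / q x)) \<partial>density M (tilted_density M p q \<alpha>))"
    by (subst integral_density) (auto simp: tilted_density_def)
  finally show ?thesis .
qed

section \<open>Kullback-Leibler divergences and the Bayes error\<close>

lemma measurable_KL_integrand [measurable]: "KL_integrand p q \<in> borel_measurable M"
  unfolding KL_integrand_def[abs_def] by measurable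

lemma AE_nonzero_if_KL_finite:
  assumes "KL_div M p q < \<infinity>"
  shows "AE x in M. p x \<noteq> 0 \<longrightarrow> q x \<noteq> 0"
proof -
  \<comment> \<open>For extended reals \<open>\<infinity> - y = \<infinity>\<close> for every
    \<open>y\<close>, even \<open>y = \<infinity>\<close>, so a finite difference forces the first
    integral to be finite.\<close>
  have "(\<integral>\<^sup>+ x. e2ennreal (KL_integrand p q x) \<partial>M) \<noteq> \<infinity>"
    using assms unfolding KL_div_def by auto
  then have "AE x in M. e2ennreal (KL_integrand p q x) \<noteq> \<infinity>"
    by (intro nn_integral_PInf_AE) auto
  then show ?thesis
    by eventually_elim (auto simp: KL_integrand_def split: if_splits)
qed

lemma not_AE_eq_if_KL_pos:
  assumes "KL_div M p q > 0"
  shows "\<not> (AE x in M. p x = q x)"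
proof
  assume eq: "AE x in M. p x = q x"
  then have "AE x in M. KL_integrand p q x = 0"
    by eventually_elim (simp add: KL_integrand_def zero_ereal_def)
  then have "(\<integral>\<^sup>+ x. e2ennreal (KL_integrand p q x) \<partial>M) = 0"
    "(\<integral>\<^sup>+ x. e2ennreal (- KL_integrand p q x) \<partial>M) = 0"
    by (subst nn_integral_0_iff_AE; auto elim!: eventually_mono simp: e2ennreal_neg)+
  then have "KL_div M p q = 0" by (simp add: KL_div_def zero_ennreal.rep_eq)
  with assms show False by simp
qed

end

text \<open>At each point exactly one of the two error events occurs, namely that of the hypothesis
  with the smaller density; at ties either choice contributes the same.\<close>

lemma error_prob_eq_tv_affinity:
  assumes dens: "is_prob_density M (\<phi> 0)" "is_prob_density M (\<phi> 1)"
    and h: "is_bayes_estimator M \<phi> h"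
  shows "2 * error_prob M \<phi> h = tv_affinity M (\<phi> 0) (\<phi> 1)"
proof -
  have [measurable]: "\<phi> 0 \<in> borel_measurable M" "\<phi> 1 \<in> borel_measurable M"
    using dens by (auto simp: is_prob_density_def)
  have hm [measurable]: "h \<in> measurable M (count_space {0, 1})" using h by (simp add: is_bayes_estimator_def)
  have h01: "h x = 0 \<or> h x = 1" and hmax: "\<phi> (h x) x \<ge> \<phi> 0 x" "\<phi> (h x) x \<ge> \<phi> 1 x" if "x \<in> space M" for x
    using h that by (auto simp: is_bayes_estimator_def is_arg_max_linorder)
  have m: "measure (density M (\<phi> z)) {x \<in> space M. h x \<noteq> z} = (\<integral>x. indicator {x \<in> space M. h x \<noteq> z} x * \<phi> z x \<partial>M)"
    and i: "integrable M (\<lambda>x. indicator {x \<in> space M. h x \<noteq> z} x * \<phi> z x)"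
    if z: "z = 0 \<or> z = 1" for z
  proof -
    have d: "is_prob_density M (\<phi> z)" using z dens by auto
    then have [measurable]: "\<phi> z \<in> borel_measurable M" and nn: "\<And>x. x \<in> space M \<Longrightarrow> \<phi> z x \<ge> 0"
      by (auto simp: is_prob_density_def)
    have A: "{x \<in> space M. h x \<noteq> z} \<in> sets M" by measurable
    show i: "integrable M (\<lambda>x. indicator {x \<in> space M. h x \<noteq> z} x * \<phi> z x)"
      using integrable_real_mult_indicator[OF A is_prob_density_integral(1)[OF d]] by (simp add: mult.commute)
    have "emeasure (density M (\<phi> z)) {x \<in> space M. h x \<noteq> z} =
        (\<integral>\<^sup>+x. ennreal (indicator {x \<in> space M. h x \<noteq> z} x * \<phi> z x) \<partial>M)"
      using A by (subst emeasure_density) (auto intro!: nn_integral_cong simp: indicator_def)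
    also have "\<dots> = ennreal (\<integral>x. indicator {x \<in> space M. h x \<noteq> z} x * \<phi> z x \<partial>M)"
      using i nn by (intro nn_integral_eq_integral) (auto simp: indicator_def)
    finally show "measure (density M (\<phi> z)) {x \<in> space M. h x \<noteq> z} = (\<integral>x. indicator {x \<in> space M. h x \<noteq> z} x * \<phi> z x \<partial>M)"
      using nn by (simp add: measure_def integral_nonneg_AE indicator_def)
  qed
  have "2 * error_prob M \<phi> h =
      (\<integral>x. indicator {x \<in> space M. h x \<noteq> 0} x * \<phi> 0 x + indicator {x \<in> space M. h x \<noteq> 1} x * \<phi> 1 x \<partial>M)"
    using i[of 0] i[of 1] by (simp add: error_prob_def m)
  also have "\<dots> = tv_affinity M (\<phi> 0) (\<phi> 1)"
    unfolding tv_affinity_def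
  proof (intro Bochner_Integration.integral_cong refl)
    fix x assume x: "x \<in> space M"
    then show "indicator {x \<in> space M. h x \<noteq> 0} x * \<phi> 0 x + indicator {x \<in> space M. h x \<noteq> 1} x * \<phi> 1 x = min (\<phi> 0 x) (\<phi> 1 x)"
      using h01[OF x] hmax[OF x] by (auto simp: min_def)
  qed
  finally show ?thesis .
qed

text \<open>The locale \<open>product_sigma_finite\<close> constrains the measures at all indices, not only those in \<open>I\<close>.\<close>

lemma exists_product_sigma_finite:
  assumes "\<And>i. i \<in> I \<Longrightarrow> sigma_finite_measure (M i)"
  obtains M' where "product_sigma_finite M'" "\<And>i. i \<in> I \<Longrightarrow> M' i = M i"
proof
  show "product_sigma_finite (\<lambda>i. if i \<in> I then M i else count_space {})"
    using assms by (auto simp: product_sigma_finite_def intro: sigma_finite_measure_count_space_finite)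
qed simp

lemma PiM_integral_prod:
  fixes f :: "'i \<Rightarrow> 'a \<Rightarrow> real"
  assumes "finite I" "\<And>i. i \<in> I \<Longrightarrow> sigma_finite_measure (M i)" "\<And>i. i \<in> I \<Longrightarrow> integrable (M i) (f i)"
  shows "(\<integral>x. (\<Prod>i\<in>I. f i (x i)) \<partial>Pi\<^sub>M I M) = (\<Prod>i\<in>I. \<integral>x. f i x \<partial>M i)"
proof -
  obtain M' where M': "product_sigma_finite M'" "\<And>i. i \<in> I \<Longrightarrow> M' i = M i"
    using exists_product_sigma_finite[of I M] assms(2) by blast
  then have "Pi\<^sub>M I M = Pi\<^sub>M I M'" by (intro PiM_cong) auto
  then show ?thesis
    using product_sigma_finite.product_integral_prod[OF M'(1) assms(1), of f] assms(3) M'(2) by simp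
qed

text \<open>Both sides agree on rectangles, where Tonelli factorizes the integral. The factors on
  the left are probability measures, hence \<sigma>-finite, and so agreement on rectangles
  determines the product.\<close>

lemma PiM_density:
  assumes I: "finite I" and sf: "\<And>i. i \<in> I \<Longrightarrow> sigma_finite_measure (M i)"
    and f [measurable]: "\<And>i. i \<in> I \<Longrightarrow> f i \<in> borel_measurable (M i)"
    and ps: "\<And>i. i \<in> I \<Longrightarrow> prob_space (density (M i) (f i))"
  shows "Pi\<^sub>M I (\<lambda>i. density (M i) (f i)) = density (Pi\<^sub>M I M) (\<lambda>x. \<Prod>i\<in>I. f i (x i))"
proof -
  obtain M' where M': "product_sigma_finite M'" "\<And>i. i \<in> I \<Longrightarrow> M' i = M i"
    using exists_product_sigma_finite[of I M] sf by blast
  interpret M': product_sigma_finite M' by fact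
  obtain N where N: "product_sigma_finite N" "\<And>i. i \<in> I \<Longrightarrow> N i = density (M i) (f i)"
    using exists_product_sigma_finite[of I "\<lambda>i. density (M i) (f i)"] ps
    by (metis prob_space_imp_sigma_finite)
  interpret N: product_sigma_finite N by fact
  have eqM: "Pi\<^sub>M I M = Pi\<^sub>M I M'" using M' by (intro PiM_cong) auto
  have eqN: "Pi\<^sub>M I (\<lambda>i. density (M i) (f i)) = Pi\<^sub>M I N" using N by (intro PiM_cong) auto
  have [measurable]: "f i \<in> borel_measurable (M' i)" if "i \<in> I" for i using f M' that by simp
  have "density (Pi\<^sub>M I M) (\<lambda>x. \<Prod>i\<in>I. f i (x i)) = Pi\<^sub>M I N"
  proof (rule N.PiM_eqI[OF I])
    show "sets (density (Pi\<^sub>M I M) (\<lambda>x. \<Prod>i\<in>I. f i (x i))) = sets (Pi\<^sub>M I N)"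
      unfolding sets_density using N by (intro sets_PiM_cong) auto
    fix A assume "\<And>i. i \<in> I \<Longrightarrow> A i \<in> sets (N i)"
    then have A [measurable]: "\<And>i. i \<in> I \<Longrightarrow> A i \<in> sets (M' i)" using N M' by simp
    have "emeasure (density (Pi\<^sub>M I M) (\<lambda>x. \<Prod>i\<in>I. f i (x i))) (Pi\<^sub>E I A)
        = (\<integral>\<^sup>+x. (\<Prod>i\<in>I. f i (x i)) * indicator (Pi\<^sub>E I A) x \<partial>Pi\<^sub>M I M')"
      unfolding eqM using I A by (intro emeasure_density sets_PiM_I_finite) auto
    also have "\<dots> = (\<integral>\<^sup>+x. (\<Prod>i\<in>I. f i (x i) * indicator (A i) (x i)) \<partial>Pi\<^sub>M I M')"
    proof (rule nn_integral_cong)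
      fix x assume "x \<in> space (Pi\<^sub>M I M')"
      then have "indicator (Pi\<^sub>E I A) x = (\<Prod>i\<in>I. indicator (A i) (x i) :: ennreal)"
        using I by (auto simp: indicator_def space_PiM PiE_iff prod_eq_1_iff if_distrib)
      then show "(\<Prod>i\<in>I. f i (x i)) * indicator (Pi\<^sub>E I A) x = (\<Prod>i\<in>I. f i (x i) * indicator (A i) (x i))"
        by (simp add: prod.distrib)
    qed
    also have "\<dots> = (\<Prod>i\<in>I. \<integral>\<^sup>+x. f i x * indicator (A i) x \<partial>M' i)"
      using I by (intro M'.product_nn_integral_prod) auto
    also have "\<dots> = (\<Prod>i\<in>I. emeasure (N i) (A i))"
      using A f by (intro prod.cong) (auto simp: N M' emeasure_density)
    finally show "emeasure (density (Pi\<^sub>M I M) (\<lambda>x. \<Prod>i\<in>I. f i (x i))) (Pi\<^sub>E I A) = (\<Prod>i\<in>I. emeasure (N i) (A i))" .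
  qed
  then show ?thesis by (simp add: eqN)
qed

section \<open>Product densities\<close>

locale product_density_pair =
  fixes n :: nat and M :: "nat \<Rightarrow> 'a measure" and \<phi> :: "nat \<Rightarrow> nat \<Rightarrow> 'a \<Rightarrow> real"
  assumes n: "n \<ge> 1"
    and sigma_finite_M: "j \<in> {1..n} \<Longrightarrow> sigma_finite_measure (M j)"
    and density_\<phi>: "z \<in> {0, 1} \<Longrightarrow> j \<in> {1..n} \<Longrightarrow> is_prob_density (M j) (\<phi> z j)"
begin

declare One_nat_def [simp del]

abbreviation "\<mu> \<equiv> Pi\<^sub>M {1..n} M"
abbreviation "\<Phi> z \<equiv> product_density n (\<phi> z)"

lemma component_pair: "j \<in> {1..n} \<Longrightarrow> density_pair (M j) (\<phi> 0 j) (\<phi> 1 j)"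
  by (simp add: density_pair_def density_pair_axioms_def sigma_finite_M density_\<phi>)

lemma is_prob_density_product:
  assumes z: "z \<in> {0, 1}"
  shows "is_prob_density \<mu> (\<Phi> z)"
  unfolding is_prob_density_def
proof (intro conjI ballI)
  have m [measurable]: "\<phi> z j \<in> borel_measurable (M j)" and nn: "\<And>x. x \<in> space (M j) \<Longrightarrow> 0 \<le> \<phi> z j x"
    and ps: "prob_space (density (M j) (\<phi> z j))" if "j \<in> {1..n}" for j
    using density_\<phi>[OF z that] by (auto simp: is_prob_density_def)
  show m\<Phi>: "\<Phi> z \<in> borel_measurable \<mu>" unfolding product_density_def[abs_def] by measurable
  have nn': "0 \<le> \<phi> z j (x j)" if "x \<in> space \<mu>" "j \<in> {1..n}" for x j
    using that nn by (auto simp: space_PiM PiE_iff)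
  show "0 \<le> \<Phi> z x" if "x \<in> space \<mu>" for x
    using nn'[OF that] unfolding product_density_def by (intro prod_nonneg) auto
  have "density \<mu> (\<Phi> z) = density \<mu> (\<lambda>x. \<Prod>j\<in>{1..n}. ennreal (\<phi> z j (x j)))"
  proof (intro density_cong AE_I2)
    fix x assume "x \<in> space \<mu>"
    then show "ennreal (\<Phi> z x) = (\<Prod>j\<in>{1..n}. ennreal (\<phi> z j (x j)))"
      unfolding product_density_def by (intro prod_ennreal[symmetric] nn')
  next
    show "(\<lambda>x. \<Prod>j\<in>{1..n}. ennreal (\<phi> z j (x j))) \<in> borel_measurable \<mu>" by measurable
  qed (use m\<Phi> in simp)
  also have "\<dots> = Pi\<^sub>M {1..n} (\<lambda>j. density (M j) (\<phi> z j))"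
    by (rule PiM_density[symmetric]) (auto intro: sigma_finite_M ps)
  finally show "prob_space (density \<mu> (\<Phi> z))"
    by (simp only:) (intro prob_space_PiM ps)
qed

lemma sigma_finite_\<mu>: "sigma_finite_measure \<mu>"
proof -
  obtain M' where M': "product_sigma_finite M'" "\<And>i. i \<in> {1..n} \<Longrightarrow> M' i = M i"
    using exists_product_sigma_finite[of "{1..n}" M] sigma_finite_M by blast
  then have "\<mu> = Pi\<^sub>M {1..n} M'" by (intro PiM_cong) auto
  then show ?thesis using product_sigma_finite.sigma_finite[OF M'(1)] by simp
qed

sublocale joint: density_pair \<mu> "\<Phi> 0" "\<Phi> 1"
  by (simp add: density_pair_def density_pair_axioms_def sigma_finite_\<mu> is_prob_density_product)

lemma \<phi>_nonneg: "x \<in> space \<mu> \<Longrightarrow> z \<in> {0, 1} \<Longrightarrow> j \<in> {1..n} \<Longrightarrow> 0 \<le> \<phi> z j (x j)"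
  using density_\<phi>[of z j] by (auto simp: is_prob_density_def space_PiM PiE_iff)

lemma geometric_mean_product:
  assumes "x \<in> space \<mu>"
  shows "geometric_mean (\<Phi> 0) (\<Phi> 1) \<alpha> x = (\<Prod>j\<in>{1..n}. geometric_mean (\<phi> 0 j) (\<phi> 1 j) \<alpha> (x j))"
  using \<phi>_nonneg[OF assms]
  by (simp add: geometric_mean_def product_density_def prod.distrib prod_powr_distrib)

lemma affinity_product:
  assumes "0 \<le> \<alpha>" "\<alpha> \<le> 1"
  shows "joint.affinity \<alpha> = (\<Prod>j\<in>{1..n}. density_pair.affinity (M j) (\<phi> 0 j) (\<phi> 1 j) \<alpha>)"
proof -
  have "joint.affinity \<alpha> = (\<integral>x. (\<Prod>j\<in>{1..n}. geometric_mean (\<phi> 0 j) (\<phi> 1 j) \<alpha> (x j)) \<partial>\<mu>)"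
    unfolding joint.affinity_def by (intro Bochner_Integration.integral_cong geometric_mean_product refl)
  also have "\<dots> = (\<Prod>j\<in>{1..n}. \<integral>x. geometric_mean (\<phi> 0 j) (\<phi> 1 j) \<alpha> x \<partial>M j)"
    using assms by (intro PiM_integral_prod sigma_finite_M density_pair.integrable_geometric_mean[OF component_pair]) auto
  also have "\<dots> = (\<Prod>j\<in>{1..n}. density_pair.affinity (M j) (\<phi> 0 j) (\<phi> 1 j) \<alpha>)"
    by (intro prod.cong refl) (simp add: density_pair.affinity_def[OF component_pair])
  finally show ?thesis .
qed

section \<open>The tilted law as a product and its centred log-likelihood ratios\<close>

context
  fixes \<alpha> :: real
  assumes \<alpha>: "0 < \<alpha>" "\<alpha> < 1" and pos: "joint.affinity \<alpha> > 0"
begin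

lemma component_affinity_pos:
  assumes "j \<in> {1..n}"
  shows "density_pair.affinity (M j) (\<phi> 0 j) (\<phi> 1 j) \<alpha> > 0"
proof -
  have "density_pair.affinity (M j) (\<phi> 0 j) (\<phi> 1 j) \<alpha> \<noteq> 0"
  proof
    assume "density_pair.affinity (M j) (\<phi> 0 j) (\<phi> 1 j) \<alpha> = 0"
    then have "(\<Prod>j\<in>{1..n}. density_pair.affinity (M j) (\<phi> 0 j) (\<phi> 1 j) \<alpha>) = 0"
      using assms by (intro prod_zero bexI[of _ j]) auto
    then show False using pos affinity_product[of \<alpha>] \<alpha> by (simp only:)
  qed
  moreover have "density_pair.affinity (M j) (\<phi> 0 j) (\<phi> 1 j) \<alpha> \<ge> 0"
    unfolding density_pair.affinity_def[OF component_pair[OF assms]] by (simp add: geometric_mean_nonneg)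
  ultimately show ?thesis by simp
qed

abbreviation "N j \<equiv> density (M j) (tilted_density (M j) (\<phi> 0 j) (\<phi> 1 j) \<alpha>)"
abbreviation "Q \<equiv> tilted_law n M (\<phi> 0) (\<phi> 1) \<alpha>"
abbreviation "Z \<equiv> centered_llr n M (\<phi> 0) (\<phi> 1) \<alpha>"
abbreviation "X j y \<equiv> ln (\<phi> 0 j (y j) / \<phi> 1 j (y j))"
abbreviation "V \<equiv> \<Sum>j=1..n. \<integral>y. (Z j y)\<^sup>2 \<partial>Q"

lemma prob_space_N: "j \<in> {1..n} \<Longrightarrow> prob_space (N j)"
  using \<alpha> by (intro density_pair.prob_space_tilted[OF component_pair] component_affinity_pos) auto

lemma Q_eq_PiM: "Q = Pi\<^sub>M {1..n} N"
  by (simp add: tilted_law_def)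

text \<open>Geometric means and affinities both factorize. This links the two views of the law:
  independence is read off the product, the mean of the total log-likelihood ratio off the joint
  density.\<close>

lemma Q_eq_density: "Q = density \<mu> (tilted_density \<mu> (\<Phi> 0) (\<Phi> 1) \<alpha>)"
proof -
  have nn: "tilted_density (M j) (\<phi> 0 j) (\<phi> 1 j) \<alpha> x \<ge> 0" for j x by (simp add: tilted_density_def)
  have [measurable]: "tilted_density (M j) (\<phi> 0 j) (\<phi> 1 j) \<alpha> \<in> borel_measurable (M j)" if "j \<in> {1..n}" for j
    by (rule density_pair.measurable_tilted_density[OF component_pair[OF that]])
  have "Q = density \<mu> (\<lambda>x. \<Prod>j\<in>{1..n}. ennreal (tilted_density (M j) (\<phi> 0 j) (\<phi> 1 j) \<alpha> (x j)))"
    unfolding Q_eq_PiM by (rule PiM_density) (auto intro: sigma_finite_M prob_space_N)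
  also have "\<dots> = density \<mu> (tilted_density \<mu> (\<Phi> 0) (\<Phi> 1) \<alpha>)"
  proof (rule density_cong)
    have "tilted_density \<mu> (\<Phi> 0) (\<Phi> 1) \<alpha> x = (\<Prod>j\<in>{1..n}. tilted_density (M j) (\<phi> 0 j) (\<phi> 1 j) \<alpha> (x j))"
      if "x \<in> space \<mu>" for x
      using geometric_mean_product[OF that, of \<alpha>] affinity_product[of \<alpha>] \<alpha> pos
      by (simp add: joint.tilted_density_eq density_pair.tilted_density_eq[OF component_pair component_affinity_pos] prod_dividef)
    then show "AE x in \<mu>. (\<Prod>j\<in>{1..n}. ennreal (tilted_density (M j) (\<phi> 0 j) (\<phi> 1 j) \<alpha> (x j))) =
        ennreal (tilted_density \<mu> (\<Phi> 0) (\<Phi> 1) \<alpha> x)"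
      by (intro AE_I2) (simp add: prod_ennreal nn)
  qed measurable
  finally show ?thesis .
qed

lemma prob_space_Q: "prob_space Q"
  unfolding Q_eq_PiM by (intro prob_space_PiM prob_space_N)

interpretation Q: prob_space Q by (rule prob_space_Q)

lemma space_Q: "space Q = space \<mu>"
  unfolding Q_eq_density by simp

lemma measurable_component_Q: "j \<in> {1..n} \<Longrightarrow> (\<lambda>y. y j) \<in> measurable Q (N j)"
  unfolding Q_eq_PiM by (rule measurable_component_singleton)

lemma distr_Q: "j \<in> {1..n} \<Longrightarrow> distr Q (N j) (\<lambda>y. y j) = N j"
  unfolding Q_eq_PiM by (rule distr_PiM_component) (auto intro: prob_space_N)

lemma measurable_llr: "j \<in> {1..n} \<Longrightarrow> (\<lambda>x. ln (\<phi> 0 j x / \<phi> 1 j x)) \<in> borel_measurable (N j)"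
  using density_pair.measurable_pq[OF component_pair] by auto

lemma measurable_X: "j \<in> {1..n} \<Longrightarrow> X j \<in> borel_measurable Q"
  using measurable_compose[OF measurable_component_Q measurable_llr] by simp

lemma measurable_Z: "j \<in> {1..n} \<Longrightarrow> Z j \<in> borel_measurable Q"
  unfolding centered_llr_def[abs_def] by (intro borel_measurable_diff measurable_X) auto

lemma indep_Z: "Q.indep_vars (\<lambda>_. borel) Z {1..n}"
proof -
  \<comment> \<open>Points of the product space are extensional, so collecting the coordinates over
    \<open>{1..n}\<close> is the identity.\<close>
  have "distr Q (Pi\<^sub>M {1..n} N) (\<lambda>y. \<lambda>j\<in>{1..n}. y j) = distr Q Q (\<lambda>y. y)"
    unfolding Q_eq_PiM by (intro distr_cong) (auto simp: space_PiM PiE_iff extensional_def fun_eq_iff)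
  also have "\<dots> = Pi\<^sub>M {1..n} (\<lambda>j. distr Q (N j) (\<lambda>y. y j))"
    unfolding distr_id2[OF refl] by (subst Q_eq_PiM) (intro PiM_cong distr_Q[symmetric] refl)
  finally have "Q.indep_vars N (\<lambda>j y. y j) {1..n}"
    using n measurable_component_Q by (subst Q.indep_vars_iff_distr_eq_PiM') auto
  then have "Q.indep_vars (\<lambda>_. borel) (\<lambda>j y. ln (\<phi> 0 j (y j) / \<phi> 1 j (y j)) - (\<integral>y. X j y \<partial>Q)) {1..n}"
    by (rule Q.indep_vars_compose2) (intro borel_measurable_diff measurable_llr borel_measurable_const, assumption)
  then show ?thesis by (simp add: centered_llr_def[abs_def])
qed

lemma
  assumes j: "j \<in> {1..n}" and k: "k > 0"
  shows integrable_X_power: "integrable Q (\<lambda>y. \<bar>X j y\<bar> ^ k)"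
    and integrable_Z_power: "integrable Q (\<lambda>y. \<bar>Z j y\<bar> ^ k)"
proof -
  define m where "m = min \<alpha> (1 - \<alpha>)"
  have m: "m > 0" using \<alpha> by (simp add: m_def)
  have "integrable (N j) (\<lambda>x. exp (m * \<bar>ln (\<phi> 0 j x / \<phi> 1 j x)\<bar>))"
    using \<alpha> by (intro density_pair.integrable_tilted_exp_abs[OF component_pair[OF j]] component_affinity_pos j) (auto simp: m_def)
  then have "integrable (distr Q (N j) (\<lambda>y. y j)) (\<lambda>x. exp (m * \<bar>ln (\<phi> 0 j x / \<phi> 1 j x)\<bar>))"
    by (simp only: distr_Q[OF j])
  then have int: "integrable Q (\<lambda>y. exp (m * \<bar>X j y\<bar>))"
    using measurable_component_Q[OF j] by (rule integrable_distr[rotated])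
  show "integrable Q (\<lambda>y. \<bar>X j y\<bar> ^ k)"
    by (rule Q.integrable_abs_power[OF measurable_X[OF j] m k int])
  define c where "c = (\<integral>y. X j y \<partial>Q)"
  have "integrable Q (\<lambda>y. exp (m * \<bar>Z j y\<bar>))"
  proof (rule Bochner_Integration.integrable_bound)
    show "integrable Q (\<lambda>y. exp (m * \<bar>c\<bar>) * exp (m * \<bar>X j y\<bar>))" using int by simp
    show "(\<lambda>y. exp (m * \<bar>Z j y\<bar>)) \<in> borel_measurable Q" using measurable_Z[OF j] by measurable
    have "m * \<bar>Z j y\<bar> \<le> m * \<bar>c\<bar> + m * \<bar>X j y\<bar>" for y
      unfolding distrib_left[symmetric] centered_llr_def c_def using m by (intro mult_left_mono) auto
    then show "AE y in Q. norm (exp (m * \<bar>Z j y\<bar>)) \<le> norm (exp (m * \<bar>c\<bar>) * exp (m * \<bar>X j y\<bar>))"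
      by (simp flip: exp_add)
  qed
  then show "integrable Q (\<lambda>y. \<bar>Z j y\<bar> ^ k)"
    by (rule Q.integrable_abs_power[OF measurable_Z[OF j] m k])
qed

lemma integrable_X: "j \<in> {1..n} \<Longrightarrow> integrable Q (X j)"
  using integrable_X_power[of j 1] measurable_X[of j] by (simp add: integrable_abs_iff)

lemma expectation_Z:
  assumes "j \<in> {1..n}"
  shows "(\<integral>y. Z j y \<partial>Q) = 0"
  using integrable_X[OF assms] Q.prob_space by (simp add: centered_llr_def)

lemma variance_Z: "j \<in> {1..n} \<Longrightarrow> Q.variance (Z j) = (\<integral>y. (Z j y)\<^sup>2 \<partial>Q)"
  by (simp add: expectation_Z)

text \<open>The means of the individual \<open>X j\<close> need not vanish, but they sum to the mean
  of the total log-likelihood ratio, which is 0, so the centring constants cancel. The logarithm of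
  the product splits only where all factors are positive, which holds almost surely.\<close>

lemma AE_sum_Z:
  assumes mean: "(\<integral>y. ln (\<Phi> 0 y / \<Phi> 1 y) \<partial>Q) = 0"
  shows "AE y in Q. (\<Sum>j\<in>{1..n}. Z j y) = ln (\<Phi> 0 y / \<Phi> 1 y)"
proof -
  have sum_X: "AE y in Q. (\<Sum>j\<in>{1..n}. X j y) = ln (\<Phi> 0 y / \<Phi> 1 y)"
    using joint.AE_tilted_pos[of \<alpha>, folded Q_eq_density] AE_space[of Q]
  proof eventually_elim
    case (elim y)
    have "0 < \<phi> z j (y j)" if "z \<in> {0, 1}" "j \<in> {1..n}" for z j
    proof -
      have "\<Phi> z y \<noteq> 0" using elim(1) that by auto
      then have "\<phi> z j (y j) \<noteq> 0" using that by (auto simp: product_density_def)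
      then show ?thesis using \<phi>_nonneg[of y z j] elim(2) that by (simp add: space_Q)
    qed
    from this[of 0] this[of 1]
    have "\<phi> 0 j (y j) / \<phi> 1 j (y j) \<noteq> 0" if "j \<in> {1..n}" for j
      using that less_imp_neq by fastforce
    then have "ln (\<Prod>j\<in>{1..n}. \<phi> 0 j (y j) / \<phi> 1 j (y j)) = (\<Sum>j\<in>{1..n}. X j y)"
      by (intro ln_prod finite_atLeastAtMost)
    then show ?case by (simp add: product_density_def prod_dividef)
  qed
  have "(\<integral>y. ln (\<Phi> 0 y / \<Phi> 1 y) \<partial>Q) = (\<integral>y. (\<Sum>j\<in>{1..n}. X j y) \<partial>Q)"
    using sum_X measurable_X joint.measurable_pq
    by (intro integral_cong_AE) (auto simp: Q_eq_density elim: eventually_mono)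
  also have "\<dots> = (\<Sum>j\<in>{1..n}. \<integral>y. X j y \<partial>Q)"
    by (intro Bochner_Integration.integral_sum integrable_X)
  finally have "(\<Sum>j\<in>{1..n}. \<integral>y. X j y \<partial>Q) = 0" using mean by simp
  note mean_X = this
  show ?thesis using sum_X by eventually_elim (simp add: centered_llr_def sum_subtractf mean_X)
qed

text \<open>If all variances vanish, the likelihood ratio is 1 almost surely under \<open>Q\<close>.
  Since \<open>Q\<close> charges the whole common support and both densities are 0 elsewhere, they
  would agree almost everywhere.\<close>

lemma variance_sum_pos:
  assumes mean: "(\<integral>y. ln (\<Phi> 0 y / \<Phi> 1 y) \<partial>Q) = 0"
    and supp: "AE x in \<mu>. \<Phi> 0 x = 0 \<longleftrightarrow> \<Phi> 1 x = 0" and neq: "\<not> (AE x in \<mu>. \<Phi> 0 x = \<Phi> 1 x)"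
  shows "V > 0"
proof (rule ccontr)
  assume "\<not> V > 0"
  moreover have "V \<ge> 0" by (intro sum_nonneg) simp
  ultimately have "V = 0" by simp
  then have zero: "(\<integral>y. (Z j y)\<^sup>2 \<partial>Q) = 0" if "j \<in> {1..n}" for j
    using that by (subst (asm) sum_nonneg_eq_0_iff) auto
  have "AE y in Q. Z j y = 0" if "j \<in> {1..n}" for j
  proof -
    have "integrable Q (\<lambda>y. (Z j y)\<^sup>2)" using integrable_Z_power[OF that, of 2] by simp
    then have "AE y in Q. (Z j y)\<^sup>2 = 0"
      using zero[OF that] by (subst (asm) integral_nonneg_eq_0_iff_AE) auto
    then show ?thesis by eventually_elim simp
  qed
  then have "AE y in Q. \<forall>j\<in>{1..n}. Z j y = 0" by (intro AE_finite_allI) auto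
  then have "AE y in Q. \<Phi> 0 y = \<Phi> 1 y"
    using AE_sum_Z[OF mean] joint.AE_tilted_pos[of \<alpha>, folded Q_eq_density]
    by eventually_elim (auto simp: ln_div)
  then have "AE y in \<mu>. tilted_density \<mu> (\<Phi> 0) (\<Phi> 1) \<alpha> y > 0 \<longrightarrow> \<Phi> 0 y = \<Phi> 1 y"
    unfolding Q_eq_density by (subst (asm) AE_density) auto
  with supp have "AE y in \<mu>. \<Phi> 0 y = \<Phi> 1 y"
    by eventually_elim (auto simp: tilted_density_def zero_less_mult_iff)
  with neq show False by simp
qed

end

end

section \<open>The bounds with explicit constants\<close>

text \<open>All constants are functions of \<open>K\<close>, so their independence of
  \<open>n\<close>, \<open>M\<close> and \<open>\<phi>\<close> is visible. Since
  \<open>sqrt (real n) * \<sigma>\<close> is the standard deviation \<open>B\<close> of the sum,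
  \<open>s\<close> equals \<open>B * (1 - \<alpha>) * \<alpha>\<close> and the moment hypothesis is
  \<open>sum_cube\<close> with \<open>C = C1\<close>.\<close>

lemma bayes_error_bounds:
  fixes C1 :: real and n :: nat and M :: "nat \<Rightarrow> 'a measure" and \<phi> :: "nat \<Rightarrow> nat \<Rightarrow> 'a \<Rightarrow> real"
  assumes C1: "C1 > 0" and K: "K \<ge> 1" "K \<ge> 4 * C1"
    and n: "n \<ge> 1" and sf: "\<forall>j\<in>{1..n}. sigma_finite_measure (M j)"
    and dens: "\<forall>z\<in>{0, 1}. \<forall>j\<in>{1..n}. is_prob_density (M j) (\<phi> z j)"
  defines "\<mu> \<equiv> Pi\<^sub>M {1..n} M"
  defines "\<Phi> \<equiv> (\<lambda>z. product_density n (\<phi> z))"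
  defines "\<alpha> \<equiv> chernoff_argmax \<mu> (\<Phi> 0) (\<Phi> 1)"
  defines "D \<equiv> chernoff_div \<mu> (\<Phi> 0) (\<Phi> 1) \<alpha>"
  defines "Q \<equiv> tilted_law n M (\<phi> 0) (\<phi> 1) \<alpha>"
  defines "Z \<equiv> centered_llr n M (\<phi> 0) (\<phi> 1) \<alpha>"
  defines "\<sigma> \<equiv> sqrt (1 / real n * (\<Sum>j=1..n. prob_space.variance Q (Z j)))"
  defines "s \<equiv> sqrt (real n) * \<sigma> * (1 - \<alpha>) * \<alpha>"
  defines "G \<equiv> prob_space.expectation (density \<mu> (tilted_density \<mu> (\<Phi> 0) (\<Phi> 1) \<alpha>))
                 (\<lambda>y. g_fun \<alpha> (ln (\<Phi> 0 y / \<Phi> 1 y)))"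
  assumes KL0: "0 < KL_div \<mu> (\<Phi> 0) (\<Phi> 1) \<and> KL_div \<mu> (\<Phi> 0) (\<Phi> 1) < \<infinity>"
    and KL1: "0 < KL_div \<mu> (\<Phi> 1) (\<Phi> 0) \<and> KL_div \<mu> (\<Phi> 1) (\<Phi> 0) < \<infinity>"
    and moment: "(\<Sum>j=1..n. prob_space.expectation Q (\<lambda>y. \<bar>Z j y\<bar> ^ 3)) \<le> C1 * real n * \<sigma>\<^sup>2"
  defines "C2 \<equiv> 64 * pi * K" and "C3 \<equiv> 2 ^ 51 * K" and "C4 \<equiv> exp (- (16384 * K)) * K / 16"
  shows "G \<le> C2 / s \<and>
    (s \<ge> C3 \<longrightarrow> G \<ge> C4 / s) \<and>
    (s \<ge> C3 \<longrightarrow>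
       C4 / s * exp (- D) \<le> tv_affinity \<mu> (\<Phi> 0) (\<Phi> 1) \<and>
       tv_affinity \<mu> (\<Phi> 0) (\<Phi> 1) \<le> C2 / s * exp (- D) \<and>
       (\<forall>h. is_bayes_estimator \<mu> \<Phi> h \<longrightarrow>
          C4 / s * exp (- D) \<le> 2 * error_prob \<mu> \<Phi> h \<and>
          2 * error_prob \<mu> \<Phi> h \<le> C2 / s * exp (- D)))"
proof -
  interpret product_density_pair n M \<phi>
    by (rule product_density_pair.intro) (use n sf dens in blast)+
  \<comment> \<open>The reverse divergence gives the other inclusion of supports.\<close>
  interpret swapped: density_pair \<mu> "\<Phi> 1" "\<Phi> 0"
    unfolding \<mu>_def \<Phi>_def by (simp add: density_pair_def density_pair_axioms_def sigma_finite_\<mu> is_prob_density_product)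
  have joint: "density_pair \<mu> (\<Phi> 0) (\<Phi> 1)"
    unfolding \<mu>_def \<Phi>_def by (rule joint.density_pair_axioms)
  interpret joint': density_pair \<mu> "\<Phi> 0" "\<Phi> 1" by (rule joint)
  have supp: "AE x in \<mu>. \<Phi> 0 x = 0 \<longleftrightarrow> \<Phi> 1 x = 0"
    using joint'.AE_nonzero_if_KL_finite[OF conjunct2[OF KL0]] swapped.AE_nonzero_if_KL_finite[OF conjunct2[OF KL1]]
    by eventually_elim auto
  have neq: "\<not> (AE x in \<mu>. \<Phi> 0 x = \<Phi> 1 x)" by (rule joint'.not_AE_eq_if_KL_pos[OF conjunct1[OF KL0]])
  note \<alpha> = joint'.chernoff_argmax_minimizes(1,2)[OF supp neq, folded \<alpha>_def]
  have pos: "joint'.affinity \<alpha> > 0" using \<alpha> by (intro joint'.affinity_pos supp) auto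
  note tilt = \<alpha> pos[unfolded \<mu>_def \<Phi>_def]
  have Q: "Q = density \<mu> (tilted_density \<mu> (\<Phi> 0) (\<Phi> 1) \<alpha>)"
    unfolding Q_def \<mu>_def \<Phi>_def by (rule Q_eq_density[OF tilt])
  have mean: "(\<integral>y. ln (\<Phi> 0 y / \<Phi> 1 y) \<partial>Q) = 0"
    unfolding Q \<alpha>_def by (rule joint'.expectation_llr_tilted_eq_0[OF supp neq])
  define V where "V = (\<Sum>j=1..n. \<integral>y. (Z j y)\<^sup>2 \<partial>Q)"
  have V: "V > 0"
    using variance_sum_pos[OF tilt mean[unfolded Q_def \<Phi>_def] supp[unfolded \<mu>_def \<Phi>_def] neq[unfolded \<mu>_def \<Phi>_def]]
    unfolding V_def Z_def Q_def .
  have "(\<Sum>j=1..n. prob_space.variance Q (Z j)) = V"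
    unfolding V_def Z_def Q_def by (intro sum.cong refl variance_Z[OF tilt])
  then have \<sigma>: "\<sigma> = sqrt (V / real n)" unfolding \<sigma>_def by simp
  have n\<sigma>: "sqrt (real n) * \<sigma> = sqrt V" "real n * \<sigma>\<^sup>2 = V"
    using n V by (auto simp: \<sigma> real_sqrt_divide power_divide)
  have s: "s = sqrt V * (1 - \<alpha>) * \<alpha>" by (simp only: s_def n\<sigma>)
  interpret Z: independent_sum Q Z "{1..n}" "sqrt V" C1
  proof (intro independent_sum.intro independent_sum_axioms.intro)
    show "prob_space Q" unfolding Q_def by (rule prob_space_Q[OF tilt])
    show "prob_space.indep_vars Q (\<lambda>_. borel) Z {1..n}"
      unfolding Q_def Z_def by (rule indep_Z[OF tilt])
    show "integrable Q (\<lambda>y. \<bar>Z j y\<bar> ^ 3)" if "j \<in> {1..n}" for j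
      unfolding Q_def Z_def by (rule integrable_Z_power[OF tilt that]) simp
    show "(\<integral>y. Z j y \<partial>Q) = 0" if "j \<in> {1..n}" for j
      unfolding Q_def Z_def by (rule expectation_Z[OF tilt that])
    show "(\<Sum>j=1..n. \<integral>y. \<bar>Z j y\<bar> ^ 3 \<partial>Q) \<le> C1 * (sqrt V)\<^sup>2"
      using moment n\<sigma>(2) V by (simp add: mult.assoc)
  qed (use V C1 in \<open>auto simp: V_def\<close>)
  have G: "G = (\<integral>y. g_fun \<alpha> (Z.S y) \<partial>Q)"
  proof -
    have "AE y in Q. (\<Sum>j\<in>{1..n}. Z j y) = ln (\<Phi> 0 y / \<Phi> 1 y)"
      using AE_sum_Z[OF tilt mean[unfolded Q_def \<Phi>_def]] unfolding Q_def Z_def \<Phi>_def .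
    then have "AE y in Q. g_fun \<alpha> (ln (\<Phi> 0 y / \<Phi> 1 y)) = g_fun \<alpha> (Z.S y)"
      by eventually_elim (simp only: Z.S_def)
    moreover have "(\<lambda>y. g_fun \<alpha> (ln (\<Phi> 0 y / \<Phi> 1 y))) \<in> borel_measurable Q"
      unfolding Q by measurable
    moreover have "(\<lambda>y. g_fun \<alpha> (Z.S y)) \<in> borel_measurable Q"
      by measurable
    ultimately show ?thesis unfolding G_def Q[symmetric] by (intro integral_cong_AE)
  qed
  have le: "G \<le> C2 / s"
    unfolding G s C2_def by (rule Z.expectation_g_le[OF \<alpha> K])
  have ge: "G \<ge> C4 / s" if "s \<ge> C3"
    using that unfolding G s C3_def C4_def by (rule Z.expectation_g_ge[OF \<alpha> K])
  have tv: "tv_affinity \<mu> (\<Phi> 0) (\<Phi> 1) = G * exp (- D)"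
    unfolding G_def D_def using joint'.tv_affinity_eq[OF pos] by (simp only: mult.commute)
  have error: "2 * error_prob \<mu> \<Phi> h = G * exp (- D)" if "is_bayes_estimator \<mu> \<Phi> h" for h
    using error_prob_eq_tv_affinity[OF joint'.density_p joint'.density_q that] tv by (simp only:)
  have upper: "G * exp (- D) \<le> C2 / s * exp (- D)" by (rule mult_right_mono[OF le]) simp
  have lower: "C4 / s * exp (- D) \<le> G * exp (- D)" if "s \<ge> C3" by (rule mult_right_mono[OF ge[OF that]]) simp
  show ?thesis using le ge upper lower by (simp add: tv error)
qed

theorem theorem2p1:
  fixes C1 :: real
  assumes "C1 > 0"
  shows "\<exists>C2 C3 C4 :: real. C3 > 0 \<and> C4 > 0 \<and>
    (\<forall>(n :: nat) (M :: nat \<Rightarrow> 'a measure) (\<phi> :: nat \<Rightarrow> nat \<Rightarrow> 'a \<Rightarrow> real).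
      n \<ge> 1 \<longrightarrow>
      (\<forall>j\<in>{1..n}. sigma_finite_measure (M j)) \<longrightarrow>
      (\<forall>z\<in>{0, 1}. \<forall>j\<in>{1..n}. is_prob_density (M j) (\<phi> z j)) \<longrightarrow>
      (let \<mu> = Pi\<^sub>M {1..n} M;
           \<Phi> = (\<lambda>z. product_density n (\<phi> z));
           \<alpha> = chernoff_argmax \<mu> (\<Phi> 0) (\<Phi> 1);
           D = chernoff_div \<mu> (\<Phi> 0) (\<Phi> 1) \<alpha>;
           Q = tilted_law n M (\<phi> 0) (\<phi> 1) \<alpha>;
           Z = centered_llr n M (\<phi> 0) (\<phi> 1) \<alpha>;
           \<sigma> = sqrt (1 / real n * (\<Sum>j=1..n. prob_space.variance Q (Z j)));
           s = sqrt (real n) * \<sigma> * (1 - \<alpha>) * \<alpha>;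
           G = prob_space.expectation (density \<mu> (tilted_density \<mu> (\<Phi> 0) (\<Phi> 1) \<alpha>))
                 (\<lambda>y. g_fun \<alpha> (ln (\<Phi> 0 y / \<Phi> 1 y)))
       in 0 < KL_div \<mu> (\<Phi> 0) (\<Phi> 1) \<and> KL_div \<mu> (\<Phi> 0) (\<Phi> 1) < \<infinity> \<longrightarrow>
          0 < KL_div \<mu> (\<Phi> 1) (\<Phi> 0) \<and> KL_div \<mu> (\<Phi> 1) (\<Phi> 0) < \<infinity> \<longrightarrow>
          (\<Sum>j=1..n. prob_space.expectation Q (\<lambda>y. \<bar>Z j y\<bar> ^ 3)) \<le> C1 * real n * \<sigma>\<^sup>2 \<longrightarrow>
          G \<le> C2 / s \<and>
          (s \<ge> C3 \<longrightarrow> G \<ge> C4 / s) \<and>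
          (s \<ge> C3 \<longrightarrow>
             C4 / s * exp (- D) \<le> tv_affinity \<mu> (\<Phi> 0) (\<Phi> 1) \<and>
             tv_affinity \<mu> (\<Phi> 0) (\<Phi> 1) \<le> C2 / s * exp (- D) \<and>
             (\<forall>h. is_bayes_estimator \<mu> \<Phi> h \<longrightarrow>
                C4 / s * exp (- D) \<le> 2 * error_prob \<mu> \<Phi> h \<and>
                2 * error_prob \<mu> \<Phi> h \<le> C2 / s * exp (- D)))))"
proof -
  \<comment> \<open>The bound \<open>4 * C1\<close> keeps the frequencies in the range where
    \<open>cf\<close> decays; the bound 1 keeps the test scale at least as wide as the
    exponential.\<close>
  define K where "K = max 1 (4 * C1)"
  have K: "K \<ge> 1" "K \<ge> 4 * C1" by (auto simp: K_def)
  show ?thesis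
    unfolding Let_def
  proof (rule exI[of _ "64 * pi * K"], rule exI[of _ "2 ^ 51 * K"], rule exI[of _ "exp (- (16384 * K)) * K / 16"],
      intro conjI)
    show "(2::real) ^ 51 * K > 0" "exp (- (16384 * K)) * K / 16 > 0" using K by auto
  qed (intro allI impI, rule bayes_error_bounds[OF assms K]; assumption)
qed

end
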